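(* Let $\lambda=(p,q,r;a,b;x)$ satisfy $p,q,r,a,b\in\mathbb{R}$, $0<p<r$, $0<q<r$, $-1<x<1$, $x\neq0$, and suppose that $\lambda$ is a non-elementary solution to the closed-form problem, with $R(w)=f(w+1)/f(w)$ written in canonical form with data $S,d,m=n,u_1,\dots,u_m,v_1,\dots,v_m$. Put $\alpha_i:=pu_i-a$ and $\beta_i:=qu_i-b$ $(i=1,\dots,m)$. Then $r$ is a positive integer and, in addition, either (A) or (B) below must be satisfied: (A) $p,q\in\mathbb{Z}$; $p+q+r$ is even; $\alpha_i,\beta_i\in\mathbb{R}\setminus\mathbb{Z}$ for $i=1,\dots,m$. (B) $p,q\in\frac12+\mathbb{Z}$; $\alpha_i,\beta_i\in\mathbb{R}\setminus\mathbb{Z}$ and $\alpha_i-(-1)^{p+q+r}\beta_i\in\frac12+\mathbb{Z}$ for $i=1,\dots,m$. Moreover the dilation constant $d$ in the gamma product formula must be $$d=\frac{r^r}{\sqrt{p^p\cdot q^q\cdot (r-p)^{r-p}\cdot (r-q)^{r-q}\cdot x^r\cdot (1-x)^{p+q-r}}}.$$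
   Context: For $\lambda=(p,q,r;a,b;x)$ put $f(w)={}_2F_1(pw+a,\,qw+b;\,rw;\,x)=\sum_{k\ge0}\frac{(pw+a)_k(qw+b)_k}{(rw)_k\,k!}x^k$, where $(t)_k=t(t+1)\cdots(t+k-1)$; this is a meromorphic function of $w\in\mathbb{C}$. $\lambda$ is a solution to the closed-form problem if $R(w):=f(w+1)/f(w)\in\mathbb{C}(w)$ is a rational function of $w$; it is elementary if $f$ has at most finitely many poles in $\mathbb{C}$, and non-elementary otherwise. A canonical form of $R(w)$ is a representation $R(w)=\frac{S(w+1)}{S(w)}\cdot d\cdot\frac{(w+u_1)\cdots(w+u_m)}{(w+v_1)\cdots(w+v_n)}$ with $S(w)$ a rational function, $d\neq0$ a constant, $u_i-v_j\notin\mathbb{Z}$ for all $i,j$, and $S$, $d$, $\prod_i(w+u_i)$, $\prod_j(w+v_j)$ real when $R$ is real. In the region considered one has $m=n$, and, after multiplying $S$ by a suitable nonzero constant, the gamma product formula $f(w)=S(w)\,d^w\,\prod_{i=1}^m\Gamma(w+u_i)/\prod_{j=1}^m\Gamma(w+v_j)$ holds; the constant $d$ here is called the dilation constant. *)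

theory Defs
  imports "HOL-Complex_Analysis.Complex_Analysis"
begin

text \<open>
  Meromorphic functions are represented by total functions, and identities between them are
  required only outside a set without accumulation points (filter \<^term>\<open>cosparse UNIV\<close>). This
  makes the values chosen by the convention \<open>z / 0 = 0\<close> at poles and zeros irrelevant; in particular
  the values of \<open>hyp_f\<close> at the points where \<open>r * w\<close> is a nonpositive integer.
  \<^const>\<open>is_pole\<close> likewise only looks at punctured neighbourhoods.
\<close>

definition gauss_2F1 :: "complex \<Rightarrow> complex \<Rightarrow> complex \<Rightarrow> complex \<Rightarrow> complex" where
  "gauss_2F1 A B C x =
     (\<Sum>k. pochhammer A k * pochhammer B k / (pochhammer C k * fact k) * x ^ k)"

definition hyp_f ::
  "complex \<Rightarrow> complex \<Rightarrow> complex \<Rightarrow> complex \<Rightarrow> complex \<Rightarrow> complex \<Rightarrow> complex \<Rightarrow> complex" where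
  "hyp_f p q r a b x w = gauss_2F1 (p * w + a) (q * w + b) (r * w) x"

text \<open>\<open>g\<close> belongs to the field of rational functions \<open>K(w)\<close>; used with \<open>K = UNIV\<close> for
  \<open>\<complex>(w)\<close> and with \<open>K = \<real>\<close> for real rational functions.\<close>

definition rational_over :: "complex set \<Rightarrow> (complex \<Rightarrow> complex) \<Rightarrow> bool" where
  "rational_over K g \<longleftrightarrow>
     (\<exists>P Q :: complex poly. Q \<noteq> 0 \<and> (\<forall>k. coeff P k \<in> K) \<and> (\<forall>k. coeff Q k \<in> K) \<and>
        eventually (\<lambda>w. g w = poly P w / poly Q w) (cosparse UNIV))"

definition shift_ratio :: "(complex \<Rightarrow> complex) \<Rightarrow> complex \<Rightarrow> complex" where
  "shift_ratio f w = f (w + 1) / f w"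

definition closed_form_solution ::
  "complex \<Rightarrow> complex \<Rightarrow> complex \<Rightarrow> complex \<Rightarrow> complex \<Rightarrow> complex \<Rightarrow> bool" where
  "closed_form_solution p q r a b x \<longleftrightarrow> rational_over UNIV (shift_ratio (hyp_f p q r a b x))"

definition elementary ::
  "complex \<Rightarrow> complex \<Rightarrow> complex \<Rightarrow> complex \<Rightarrow> complex \<Rightarrow> complex \<Rightarrow> bool" where
  "elementary p q r a b x \<longleftrightarrow> finite {w. is_pole (hyp_f p q r a b x) w}"

text \<open>The canonical form
  \<open>R(w) = S(w+1) / S(w) * d * ((w+u 1) ... (w+u m)) / ((w+v 1) ... (w+v n))\<close>.
  When \<open>m = n\<close>, its constant \<open>d\<close> is the dilation constant of the gamma product formula
  \<open>f(w) = S(w) * d^w * (\<Gamma>(w+u 1) ... \<Gamma>(w+u m)) / (\<Gamma>(w+v 1) ... \<Gamma>(w+v m))\<close>.\<close>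

definition canonical_form ::
  "(complex \<Rightarrow> complex) \<Rightarrow> (complex \<Rightarrow> complex) \<Rightarrow> complex \<Rightarrow>
     nat \<Rightarrow> (nat \<Rightarrow> complex) \<Rightarrow> nat \<Rightarrow> (nat \<Rightarrow> complex) \<Rightarrow> bool" where
  "canonical_form R S d m u n v \<longleftrightarrow>
     rational_over UNIV S \<and>
     \<not> eventually (\<lambda>w. S w = 0) (cosparse UNIV) \<and>
     d \<noteq> 0 \<and>
     (\<forall>i\<in>{1..m}. \<forall>j\<in>{1..n}. u i - v j \<notin> \<int>) \<and>
     eventually (\<lambda>w. R w =
        S (w + 1) / S w * d * ((\<Prod>i=1..m. w + u i) / (\<Prod>j=1..n. w + v j))) (cosparse UNIV) \<and>
     (rational_over \<real> R \<longrightarrow>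
        rational_over \<real> S \<and> d \<in> \<real> \<and>
        (\<forall>k. coeff (\<Prod>i=1..m. [:u i, 1:]) k \<in> \<real>) \<and>
        (\<forall>k. coeff (\<Prod>j=1..n. [:v j, 1:]) k \<in> \<real>))"

end

theory Submission
  imports Defs "HOL-Real_Asymp.Real_Asymp"
begin

text \<open>
  Write \<open>f = G / E\<close> with \<open>E w = 1 / \<Gamma>(r w)\<close> and \<open>G\<close> the regularised hypergeometric function; both are
  entire, and \<open>f (w + 1) = R w * f w\<close> becomes an identity between entire functions. Laplace's method
  applied to Euler's integral shows that \<open>G\<close> and \<open>E\<close> have no zeros at \<open>c + n\<close> for large \<open>n\<close>, so
  iterating this identity forces a simple pole of \<open>f\<close> at every \<open>- u i - k\<close> with \<open>k\<close> large. As the poles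
  lie in \<open>- \<nat> / r\<close>, both \<open>r\<close> and \<open>r * u i\<close> are integers. The constant \<open>d\<close> is then computed twice:
  as the limit of \<open>R\<close> to the right, where Laplace's method gives \<open>f (n + 1) / f n\<close>, and as the limit of
  ratios of consecutive residues to the left, where the reflection formula turns the residues into
  \<open>s k = sin (\<pi> (\<alpha> i + p k)) * sin (\<pi> (\<beta> i + q k))\<close> times quantities which are again governed
  by Laplace's method. Hence \<open>s (k + 1) / s k\<close> converges to some \<open>L\<close>. A linear recurrence satisfied by \<open>s\<close> forces
  \<open>L = 1\<close> or \<open>L = - 1\<close>; the absolute value of this equation is the formula for \<open>d\<^sup>2\<close>, its sign together
  with the convergence gives the arithmetic conditions, and a crude bound on the integrals shows that
  it cannot hold for \<open>x < 0\<close>.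
\<close>

subsection \<open>Laplace's method on the unit interval\<close>

text \<open>The maximiser of the phase is a root of a quadratic, so the value M =
  \<open>euler_peak p q (r - q) x\<close> has no simple form, and yet d has one. M is in fact never
  computed. To the right, d is M divided by the peak for first parameter 0, a constant of Beta type.
  To the left, the value of the numerator at a pole again contains a Gauss function, now with p and
  q replaced by r - p and r - q. Euler's transformation, here the substitution t -> (1 - t) / (1 - x
  t) inside the phase, turns its peak into a power of 1 - x times M. Equating the two values of d
  therefore determines the square of M, which is where the square root in the formula comes from.

  L has so few possible values because the characteristic roots of the recurrence lie on the unit
  circle: they are exp (+- i pi (p - q)) and exp (+- i pi (p + q)), and a real number among them is
  1 or -1.

  All identities are cleared of denominators before they are used, since f has to be studied exactly
  at its poles, where the quotient in HOL carries no information.\<close>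

lemma integral_power_pos:
  fixes \<Phi> :: "real \<Rightarrow> real"
  assumes "continuous_on {0..1} \<Phi>" "\<And>t. t \<in> {0..1} \<Longrightarrow> 0 \<le> \<Phi> t"
    and "t0 \<in> {0..1}" "0 < \<Phi> t0"
  shows "0 < integral {0..1} (\<lambda>t. \<Phi> t ^ n)"
proof -
  have cont: "continuous_on {0..1} (\<lambda>t. \<Phi> t ^ n)"
    using assms(1) by (intro continuous_intros)
  have nn: "0 \<le> integral {0..1} (\<lambda>t. \<Phi> t ^ n)"
    by (rule integral_nonneg) (use cont assms(2) in \<open>auto intro: integrable_continuous_real\<close>)
  have "integral {0..1} (\<lambda>t. \<Phi> t ^ n) \<noteq> 0"
  proof
    assume "integral {0..1} (\<lambda>t. \<Phi> t ^ n) = 0"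
    then have "((\<lambda>t. \<Phi> t ^ n) has_integral 0) (cbox 0 1)"
      using cont integrable_continuous_real[OF cont] by (simp add: has_integral_integral)
    from has_integral_0_cbox_imp_0[OF _ _ this, of t0] have "\<Phi> t0 ^ n = 0"
      using cont assms by auto
    then show False using assms(4) by simp
  qed
  with nn show ?thesis by simp
qed

text \<open>Divided by its integral, \<open>\<Phi> ^ n\<close> is an approximate identity at the
  strict maximum. Later only ratios of integrals occur, so this qualitative form of Laplace's method
  suffices; neither derivatives of \<open>\<Phi>\<close> nor the Gaussian leading term
  enter.\<close>

lemma laplace_concentration:
  fixes \<Phi> :: "real \<Rightarrow> real" and g :: "real \<Rightarrow> complex"
  assumes cont: "continuous_on {0..1} \<Phi>" and nonneg: "\<And>t. t \<in> {0..1} \<Longrightarrow> 0 \<le> \<Phi> t"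
    and t0: "t0 \<in> {0..1}" and max: "\<And>t. t \<in> {0..1} \<Longrightarrow> t \<noteq> t0 \<Longrightarrow> \<Phi> t < \<Phi> t0"
    and g: "continuous_on {0..1} g"
  shows "(\<lambda>n. integral {0..1} (\<lambda>t. of_real (\<Phi> t ^ n) * g t) /
              of_real (integral {0..1} (\<lambda>t. \<Phi> t ^ n))) \<longlonglongrightarrow> g t0"
proof (rule LIMSEQ_I)
  fix e :: real assume "0 < e"
  define N where "N n = integral {0..1} (\<lambda>t. \<Phi> t ^ n)" for n
  \<comment> \<open>A second point of the interval makes the maximum strictly positive:
    \<open>0 \<le> \<Phi> t1 < \<Phi> t0\<close>.\<close>
  obtain t1 :: real where t1: "t1 \<in> {0..1}" "t1 \<noteq> t0"
    by (cases "t0 = 0") (use t0 in \<open>auto intro: that[of 0] that[of 1]\<close>)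
  have pos: "0 < \<Phi> t0" using max[OF t1] nonneg[OF t1(1)] by simp
  have Npos: "0 < N n" for n
    unfolding N_def by (rule integral_power_pos[OF cont nonneg t0 pos])
  have int_pow: "(\<lambda>t. \<Phi> t ^ n) integrable_on {0..1}" for n
    using cont by (intro integrable_continuous_real continuous_intros)
  have int_g: "(\<lambda>t. of_real (\<Phi> t ^ n) * h t) integrable_on {0..1}"
    if "continuous_on {0..1} h" for n and h :: "real \<Rightarrow> complex"
    using cont that by (intro integrable_continuous_real continuous_intros)
  obtain \<delta> where \<delta>: "\<delta> > 0" "\<And>t. t \<in> {0..1} \<Longrightarrow> \<bar>t - t0\<bar> < \<delta> \<Longrightarrow> norm (g t - g t0) < e / 2"
    using g t0 \<open>0 < e\<close> unfolding continuous_on_iff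
    by (metis dist_norm dist_real_def half_gt_zero)
  obtain B where B: "\<And>t. t \<in> {0..1} \<Longrightarrow> norm (g t - g t0) \<le> B"
  proof -
    have "compact ((\<lambda>t. g t - g t0) ` {0..1})"
      using g by (intro compact_continuous_image continuous_intros) auto
    then show ?thesis
      using that by (metis bounded_iff compact_imp_bounded imageI)
  qed
  have Bnn: "0 \<le> B" using B[OF t0] by simp
  define K where "K = {0..1} - ball t0 \<delta>"
  obtain M1 where M1: "0 \<le> M1" "M1 < \<Phi> t0" "\<And>t. t \<in> K \<Longrightarrow> \<Phi> t \<le> M1"
  proof (cases "K = {}")
    case True
    then show ?thesis using that[of 0] pos by auto
  next
    case False
    have "compact K" unfolding K_def by (intro compact_diff) auto
    moreover have "continuous_on K \<Phi>" using cont by (rule continuous_on_subset) (auto simp: K_def)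
    ultimately obtain s where s: "s \<in> K" "\<And>t. t \<in> K \<Longrightarrow> \<Phi> t \<le> \<Phi> s"
      using continuous_attains_sup[of K \<Phi>] False by blast
    have "s \<noteq> t0" using s(1) \<open>\<delta> > 0\<close> by (auto simp: K_def)
    then show ?thesis
      by (intro that[of "\<Phi> s"]) (use s max[of s] nonneg[of s] in \<open>auto simp: K_def\<close>)
  qed
  \<comment> \<open>A level strictly between the bound \<open>M1\<close> away from \<open>t0\<close>
    and the maximum. \<open>\<Phi>\<close> stays above it on a whole interval, so \<open>N n\<close>
    is at least a constant times \<open>M2 ^ n\<close> and swamps the far contribution of order
    \<open>M1 ^ n\<close>.\<close>
  define M2 where "M2 = (M1 + \<Phi> t0) / 2"
  have M2: "M1 < M2" "M2 < \<Phi> t0" "0 < M2" using M1 by (auto simp: M2_def)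
  obtain \<eta> where \<eta>: "\<eta> > 0" "\<And>t. t \<in> {0..1} \<Longrightarrow> \<bar>t - t0\<bar> < \<eta> \<Longrightarrow> \<bar>\<Phi> t - \<Phi> t0\<bar> < \<Phi> t0 - M2"
    using cont t0 M2(2) unfolding continuous_on_iff
    by (metis dist_real_def diff_gt_0_iff_gt)
  define c where "c = max 0 (t0 - \<eta> / 2)"
  define e' where "e' = min 1 (t0 + \<eta> / 2)"
  have ce: "c < e'" "{c..e'} \<subseteq> {0..1}" using t0 \<eta>(1) by (auto simp: c_def e'_def)
  have near: "M2 \<le> \<Phi> t" if "t \<in> {c..e'}" for t
  proof -
    have "\<bar>t - t0\<bar> < \<eta>" using that \<eta>(1) by (auto simp: c_def e'_def)
    then show ?thesis using \<eta>(2)[of t] that ce by fastforce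
  qed
  have int_sub: "(\<lambda>t. \<Phi> t ^ n) integrable_on {c..e'}" for n
    by (rule integrable_on_subinterval[OF int_pow ce(2)])
  have Nlow: "(e' - c) * M2 ^ n \<le> N n" for n
  proof -
    have "(e' - c) * M2 ^ n = integral {c..e'} (\<lambda>_. M2 ^ n)" using ce by simp
    also have "\<dots> \<le> integral {c..e'} (\<lambda>t. \<Phi> t ^ n)"
      using near M2 int_sub by (intro integral_le power_mono) auto
    also have "\<dots> \<le> N n" unfolding N_def
      using nonneg ce int_pow int_sub by (intro integral_subset_le) auto
    finally show ?thesis .
  qed
  have main: "norm (integral {0..1} (\<lambda>t. of_real (\<Phi> t ^ n) * g t) / of_real (N n) - g t0)
               \<le> e / 2 + B * (M1 / M2) ^ n / (e' - c)" for n
  proof -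
    have pw: "norm (of_real (\<Phi> t ^ n) * (g t - g t0)) \<le> e / 2 * \<Phi> t ^ n + B * M1 ^ n"
      if t: "t \<in> {0..1}" for t
    proof (cases "t \<in> K")
      case True
      have "norm (of_real (\<Phi> t ^ n) * (g t - g t0)) = \<Phi> t ^ n * norm (g t - g t0)"
        using nonneg[OF t] by (simp add: norm_mult norm_power)
      also have "\<dots> \<le> M1 ^ n * B"
        using M1 True B t nonneg by (intro mult_mono power_mono) auto
      finally show ?thesis using \<open>0 < e\<close> nonneg[OF t] by (simp add: mult.commute add_increasing)
    next
      case False
      then have "\<bar>t - t0\<bar> < \<delta>" using t by (auto simp: K_def dist_real_def)
      then have "norm (g t - g t0) \<le> e / 2" using \<delta>(2)[OF t] by simp
      then have "norm (of_real (\<Phi> t ^ n) * (g t - g t0)) \<le> \<Phi> t ^ n * (e / 2)"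
        unfolding norm_mult using nonneg[OF t] by (intro mult_mono) (auto simp: norm_power)
      moreover have "0 \<le> B * M1 ^ n" using Bnn M1 by simp
      ultimately show ?thesis by (simp only: mult.commute[of "e / 2"])
    qed
    have int_d: "(\<lambda>t. of_real (\<Phi> t ^ n) * (g t - g t0)) integrable_on {0..1}"
      using g by (intro int_g continuous_intros)
    have "integral {0..1} (\<lambda>t. of_real (\<Phi> t ^ n) * (g t - g t0)) =
          integral {0..1} (\<lambda>t. of_real (\<Phi> t ^ n) * g t - of_real (\<Phi> t ^ n) * g t0)"
      by (simp add: algebra_simps)
    also have "\<dots> = integral {0..1} (\<lambda>t. of_real (\<Phi> t ^ n) * g t)
                 - integral {0..1} (\<lambda>t. of_real (\<Phi> t ^ n) * g t0)"
      by (intro integral_diff int_g g continuous_intros)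
    also have "integral {0..1} (\<lambda>t. of_real (\<Phi> t ^ n) * g t0) = of_real (N n) * g t0"
    proof -
      have "((\<lambda>t. of_real (\<Phi> t ^ n) :: complex) has_integral of_real (N n)) {0..1}"
        unfolding N_def using has_integral_of_real[OF integrable_integral[OF int_pow]] .
      then have "((\<lambda>t. of_real (\<Phi> t ^ n) * g t0) has_integral of_real (N n) * g t0) {0..1}"
        by (rule has_integral_mult_left)
      then show ?thesis by (rule integral_unique)
    qed
    finally have "integral {0..1} (\<lambda>t. of_real (\<Phi> t ^ n) * g t) / of_real (N n) - g t0
        = integral {0..1} (\<lambda>t. of_real (\<Phi> t ^ n) * (g t - g t0)) / of_real (N n)"
      using Npos[of n] by (simp add: field_simps)
    also have "norm \<dots> = norm (integral {0..1} (\<lambda>t. of_real (\<Phi> t ^ n) * (g t - g t0))) / N n"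
      using Npos[of n] by (simp add: norm_divide)
    also have "\<dots> \<le> (e / 2 * N n + B * M1 ^ n) / N n"
    proof -
      have int2: "(\<lambda>t. e / 2 * \<Phi> t ^ n + B * M1 ^ n) integrable_on {0..1}"
        using cont by (intro integrable_continuous_real continuous_intros)
      have "norm (integral {0..1} (\<lambda>t. of_real (\<Phi> t ^ n) * (g t - g t0)))
            \<le> integral {0..1} (\<lambda>t. e / 2 * \<Phi> t ^ n + B * M1 ^ n)"
        by (rule integral_norm_bound_integral[OF int_d int2 pw])
      also have "\<dots> = e / 2 * N n + B * M1 ^ n"
      proof -
        have "(\<lambda>t. e / 2 * \<Phi> t ^ n) integrable_on {0..1}"
          using cont by (intro integrable_continuous_real continuous_intros)
        from integral_add[OF this integrable_const_ivl[of "B * M1 ^ n"]] show ?thesis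
          unfolding N_def by simp
      qed
      finally show ?thesis using Npos[of n] by (intro divide_right_mono) auto
    qed
    also have "\<dots> = e / 2 + B * M1 ^ n / N n" using Npos[of n] by (simp add: field_simps)
    also have "B * M1 ^ n / N n \<le> B * M1 ^ n / ((e' - c) * M2 ^ n)"
      using Nlow[of n] Bnn M1 M2 ce by (intro divide_left_mono mult_pos_pos Npos) auto
    also have "\<dots> = B * (M1 / M2) ^ n / (e' - c)" by (simp add: power_divide)
    finally show ?thesis by simp
  qed
  have "(\<lambda>n. (M1 / M2) ^ n) \<longlonglongrightarrow> 0"
    using M1 M2 by (intro LIMSEQ_realpow_zero) auto
  then have "(\<lambda>n. e / 2 + B / (e' - c) * (M1 / M2) ^ n) \<longlonglongrightarrow> e / 2 + B / (e' - c) * 0"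
    by (intro tendsto_add tendsto_mult tendsto_const)
  then have "(\<lambda>n. e / 2 + B * (M1 / M2) ^ n / (e' - c)) \<longlonglongrightarrow> e / 2" by simp
  from order_tendstoD(2)[OF this, of e] \<open>0 < e\<close>
  have "eventually (\<lambda>n. e / 2 + B * (M1 / M2) ^ n / (e' - c) < e) sequentially" by simp
  then obtain no where "\<And>n. n \<ge> no \<Longrightarrow> e / 2 + B * (M1 / M2) ^ n / (e' - c) < e"
    unfolding eventually_sequentially by blast
  then show "\<exists>no. \<forall>n\<ge>no. norm (integral {0..1} (\<lambda>t. of_real (\<Phi> t ^ n) * g t) /
              of_real (integral {0..1} (\<lambda>t. \<Phi> t ^ n)) - g t0) < e"
    using main unfolding N_def by (meson le_less_trans)
qed

subsection \<open>The phase function of Euler's integral\<close>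

text \<open>Raising A, B and C by p, q and q + s multiplies the integrand of Euler's integral for
  2F1(A, B; C; x) by this function, so its n-th power carries the growth after n steps.\<close>

definition euler_phase :: "real \<Rightarrow> real \<Rightarrow> real \<Rightarrow> real \<Rightarrow> real \<Rightarrow> real" where
  "euler_phase p q s x t = t powr q * (1 - t) powr s * (1 - x * t) powr (- p)"

definition euler_peak :: "real \<Rightarrow> real \<Rightarrow> real \<Rightarrow> real \<Rightarrow> real" where
  "euler_peak p q s x = Sup (euler_phase p q s x ` {0..1})"

lemma one_minus_mult_pos:
  fixes x t :: real
  assumes "\<bar>x\<bar> < 1" "t \<in> {0..1}"
  shows "0 < 1 - x * t"
proof -
  have "x * t \<le> \<bar>x\<bar> * t" using assms by (intro mult_right_mono) auto
  also have "\<dots> \<le> \<bar>x\<bar> * 1" using assms by (intro mult_left_mono) auto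
  finally show ?thesis using assms by simp
qed

lemma euler_phase_nonneg: "0 \<le> euler_phase p q s x t"
  by (simp add: euler_phase_def)

lemma euler_phase_pos:
  assumes "\<bar>x\<bar> < 1" "t \<in> {0<..<1}"
  shows "0 < euler_phase p q s x t"
  using assms one_minus_mult_pos[of x t] by (simp add: euler_phase_def)

lemma continuous_on_euler_phase:
  assumes "0 < q" "0 < s" "\<bar>x\<bar> < 1"
  shows "continuous_on {0..1} (euler_phase p q s x)"
proof -
  have "1 - x * t \<noteq> 0" if "t \<in> {0..1}" for t
    using one_minus_mult_pos[OF assms(3) that] by simp
  then show ?thesis unfolding euler_phase_def
    using assms by (intro continuous_intros continuous_on_powr') auto
qed

lemma euler_phase_critical:
  assumes "\<bar>x\<bar> < 1" and t: "t \<in> {0<..<1}"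
    and max: "\<And>y. y \<in> {0..1} \<Longrightarrow> euler_phase p q s x y \<le> euler_phase p q s x t"
  shows "q * (1 - t) * (1 - x * t) - s * t * (1 - x * t) + p * x * t * (1 - t) = 0"
proof -
  have pos: "0 < 1 - x * t" using one_minus_mult_pos[OF assms(1)] t by simp
  \<comment> \<open>The logarithmic derivative of the phase at t; clearing its denominators gives
    the claim.\<close>
  define D where "D = q / t - s / (1 - t) + p * x / (1 - x * t)"
  have "(euler_phase p q s x has_field_derivative euler_phase p q s x t * D) (at t)"
  proof -
    have d1: "((\<lambda>t. t powr q) has_field_derivative t powr q * (q / t)) (at t)"
      using t by (auto intro!: derivative_eq_intros simp: powr_diff)
    have d2: "((\<lambda>t. (1 - t) powr s) has_field_derivative (1 - t) powr s * (- (s / (1 - t)))) (at t)"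
      using t by (auto intro!: derivative_eq_intros simp: powr_diff)
    have d3: "((\<lambda>t. (1 - x * t) powr (- p)) has_field_derivative
        (1 - x * t) powr (- p) * (p * x / (1 - x * t))) (at t)"
      using pos by (auto intro!: derivative_eq_intros simp: powr_diff)
    have "((\<lambda>t. t powr q * (1 - t) powr s * (1 - x * t) powr (- p)) has_field_derivative
        (t powr q * (q / t) * (1 - t) powr s + (1 - t) powr s * (- (s / (1 - t))) * t powr q)
          * (1 - x * t) powr (- p)
        + (1 - x * t) powr (- p) * (p * x / (1 - x * t)) * (t powr q * (1 - t) powr s)) (at t)"
      by (rule DERIV_mult[OF DERIV_mult[OF d1 d2] d3])
    note deriv = this
    have alg: "(a * u * b + b * (- v) * a) * c + c * w * (a * b) = a * b * c * (u - v + w)"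
      for a b c u v w :: real
      by (simp add: algebra_simps)
    show ?thesis unfolding euler_phase_def[abs_def] D_def by (rule deriv[unfolded alg])
  qed
  moreover have "\<forall>y. \<bar>t - y\<bar> < min t (1 - t) \<longrightarrow> euler_phase p q s x y \<le> euler_phase p q s x t"
  proof (intro allI impI)
    fix y assume "\<bar>t - y\<bar> < min t (1 - t)"
    then have "y \<in> {0..1}" by (auto simp: abs_less_iff)
    then show "euler_phase p q s x y \<le> euler_phase p q s x t" by (rule max)
  qed
  ultimately have "euler_phase p q s x t * D = 0"
    using t by (intro DERIV_local_max[of _ _ t "min t (1 - t)"]) auto
  then have "D = 0" using euler_phase_pos[OF assms(1) t] by (metis less_irrefl mult_eq_0_iff)
  then have "0 = D * (t * (1 - t) * (1 - x * t))" by simp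
  also have "\<dots> = q * (1 - t) * (1 - x * t) - s * t * (1 - x * t) + p * x * t * (1 - t)"
    using t pos by (simp add: D_def distrib_right left_diff_distrib)
  finally show ?thesis by simp
qed

text \<open>Interior critical points are roots of a quadratic polynomial \<open>Q\<close> with \<open>Q 0 > 0 > Q 1\<close>.\<close>

lemma euler_phase_unique_max:
  assumes "0 < q" "0 < s" "\<bar>x\<bar> < 1"
  obtains t0 where "t0 \<in> {0<..<1}" "euler_peak p q s x = euler_phase p q s x t0"
    "\<And>t. t \<in> {0..1} \<Longrightarrow> t \<noteq> t0 \<Longrightarrow> euler_phase p q s x t < euler_phase p q s x t0"
proof -
  let ?\<Phi> = "euler_phase p q s x"
  obtain t0 where t0: "t0 \<in> {0..1}" "\<And>t. t \<in> {0..1} \<Longrightarrow> ?\<Phi> t \<le> ?\<Phi> t0"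
    using continuous_attains_sup[OF _ _ continuous_on_euler_phase[OF assms], of p] by auto
  have interior: "t \<in> {0<..<1}" if "t \<in> {0..1}" "?\<Phi> t0 \<le> ?\<Phi> t" for t
  proof -
    have "0 < ?\<Phi> (1/2)" by (rule euler_phase_pos) (use assms in auto)
    also have "\<dots> \<le> ?\<Phi> t" using t0(2)[of "1/2"] that by simp
    finally show ?thesis using that(1) by (cases "t = 0 \<or> t = 1") (auto simp: euler_phase_def)
  qed
  have "?\<Phi> t < ?\<Phi> t0" if t: "t \<in> {0..1}" "t \<noteq> t0" for t
  proof (rule ccontr)
    assume "\<not> ?\<Phi> t < ?\<Phi> t0"
    then have ge: "?\<Phi> t0 \<le> ?\<Phi> t" by simp
    define Q where "Q y = q * (1 - y) * (1 - x * y) - s * y * (1 - x * y) + p * x * y * (1 - y)" for y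
    define c where "c = q * x + s * x - p * x"
    define b where "b = p * x - q - q * x - s"
    have Q: "Q y = q + b * y + c * y\<^sup>2" for y
      by (simp add: Q_def b_def c_def power2_eq_square algebra_simps)
    have in01: "t \<in> {0<..<1}" "t0 \<in> {0<..<1}" using interior t(1) ge t0(1) by auto
    have "Q t = 0" "Q t0 = 0"
      unfolding Q_def using in01 t0(2) order_trans[OF t0(2) ge]
      by (blast intro: euler_phase_critical[OF assms(3)])+
    then have e: "q + b * t + c * t\<^sup>2 = 0" "q + b * t0 + c * t0\<^sup>2 = 0" by (simp_all add: Q)
    \<comment> \<open>Vieta's relations: with two distinct roots, Q y = c (y - t) (y - t0), so Q 0
      and Q 1 would both have the sign of c.\<close>
    then have "(t - t0) * (b + c * (t + t0)) = 0" by (simp add: algebra_simps power2_eq_square)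
    then have b: "b = - c * (t + t0)" using t(2) by simp
    have q: "q = c * (t * t0)" using e(1) unfolding b by (simp add: algebra_simps power2_eq_square)
    have "Q 1 = c * ((1 - t) * (1 - t0))" unfolding Q b q by (simp add: algebra_simps)
    moreover have "Q 1 = s * (x - 1)" by (simp add: Q_def algebra_simps)
    moreover have "s * (x - 1) < 0" using assms by (simp add: mult_pos_neg)
    moreover have "0 < c" using q assms(1) in01
      by (metis greaterThanLessThan_iff mult_pos_pos zero_less_mult_pos2)
    ultimately show False using in01 by (simp add: mult_less_0_iff)
  qed
  moreover have "euler_peak p q s x = ?\<Phi> t0"
    unfolding euler_peak_def by (rule cSup_eq_maximum) (use t0 in auto)
  ultimately show ?thesis using that interior[OF t0(1)] by blast
qed

lemma euler_phase_le_peak: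
  assumes "0 < q" "0 < s" "\<bar>x\<bar> < 1" "t \<in> {0..1}"
  shows "euler_phase p q s x t \<le> euler_peak p q s x"
  using euler_phase_unique_max[OF assms(1-3), of p] assms(4) by (metis less_imp_le order_refl)

lemma euler_peak_pos:
  assumes "0 < q" "0 < s" "\<bar>x\<bar> < 1"
  shows "0 < euler_peak p q s x"
  using euler_phase_unique_max[OF assms, of p] euler_phase_pos[OF assms(3)] by metis

text \<open>The map t -> (1 - t) / (1 - x t) is an involution of the unit interval exchanging its
  end points. It is the substitution behind Euler's transformation of F(A, B; C; x) into (1 - x)^(C
  - A - B) F(C - A, C - B; C; x); with r = q + s it replaces p, q by r - p, r - q.\<close>

lemma euler_phase_moebius:
  assumes x: "\<bar>x\<bar> < 1" and t: "t \<in> {0<..<1}"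
  shows "euler_phase (q + s - p) s q x ((1 - t) / (1 - x * t)) =
         (1 - x) powr (p - s) * euler_phase p q s x t"
proof -
  have pos: "0 < 1 - x * t" using one_minus_mult_pos[OF x] t by simp
  have x1: "0 < 1 - x" using x by simp
  have e1: "1 - (1 - t) / (1 - x * t) = t * (1 - x) / (1 - x * t)"
    and e2: "1 - x * ((1 - t) / (1 - x * t)) = (1 - x) / (1 - x * t)"
    using pos by (simp_all add: field_simps)
  have algebraic: "(T / Y) powr s * (t * X / Y) powr q * (X / Y) powr - (q + s - p)
      = X powr (p - s) * (t powr q * T powr s * Y powr - p)"
    if "0 < X" "0 < Y" "0 < T" "0 < t" for X Y T t :: real
    using that by (simp add: powr_def ln_mult ln_div exp_add[symmetric] algebra_simps)
  show ?thesis unfolding euler_phase_def e1 e2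
    by (rule algebraic) (use t pos x1 in auto)
qed

text \<open>This links the peak met at the poles on the left with the peak that determines d on the
  right.\<close>

lemma euler_peak_dual:
  assumes "0 < q" "0 < s" "\<bar>x\<bar> < 1"
  shows "euler_peak (q + s - p) s q x = (1 - x) powr (p - s) * euler_peak p q s x"
proof -
  have le: "(1 - x) powr (p - s) * euler_peak p q s x \<le> euler_peak (q + s - p) s q x"
    if qs: "0 < q" "0 < s" for p q s
  proof -
    obtain t0 where t0: "t0 \<in> {0<..<1}" "euler_peak p q s x = euler_phase p q s x t0"
      using euler_phase_unique_max[OF qs assms(3)] by metis
    have pos: "0 < 1 - x * t0" using one_minus_mult_pos[OF assms(3)] t0 by simp
    have "t0 * x \<le> t0 * 1" using t0 assms(3) by (intro mult_left_mono) auto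
    then have le: "1 - t0 \<le> 1 - x * t0" by (simp add: mult.commute[of x])
    have "0 \<le> (1 - t0) / (1 - x * t0)" by (rule divide_nonneg_pos) (use t0 pos in auto)
    moreover have "(1 - t0) / (1 - x * t0) \<le> 1" unfolding divide_le_eq_1_pos[OF pos] by (rule le)
    ultimately have "(1 - t0) / (1 - x * t0) \<in> {0..1}" by simp
    from euler_phase_le_peak[OF qs(2,1) assms(3) this, of "q + s - p"]
    show ?thesis using euler_phase_moebius[OF assms(3) t0(1)] t0(2) by metis
  qed
  \<comment> \<open>The dual of the dual parameters is the original triple, so the same inequality,
    applied to the dual, is the converse one.\<close>
  have "(1 - x) powr (s - p) * euler_peak (q + s - p) s q x \<le> euler_peak p q s x"
    using le[of s q "q + s - p"] assms by simp
  then have "(1 - x) powr (p - s) * ((1 - x) powr (s - p) * euler_peak (q + s - p) s q x)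
      \<le> (1 - x) powr (p - s) * euler_peak p q s x"
    by (intro mult_left_mono) auto
  also have "(1 - x) powr (p - s) * ((1 - x) powr (s - p) * euler_peak (q + s - p) s q x)
      = euler_peak (q + s - p) s q x"
    using assms(3) by (simp add: mult.assoc[symmetric] powr_add[symmetric])
  finally show ?thesis using le[of q s p] assms by simp
qed

text \<open>For negative x the factor (1 - x t)^(-p) is at most 1. Together with
  \<open>euler_peak_0_less_1\<close> this gives the bound that excludes x < 0 in
  \<open>peak_equation\<close>.\<close>

lemma euler_peak_mono_neg:
  assumes "0 < q" "0 < s" "-1 < x" "x < 0" "0 \<le> p"
  shows "euler_peak p q s x \<le> euler_peak 0 q s x"
proof -
  have x: "\<bar>x\<bar> < 1" using assms by simp
  obtain t0 where t0: "t0 \<in> {0<..<1}" "euler_peak p q s x = euler_phase p q s x t0"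
    using euler_phase_unique_max[OF assms(1,2) x] by metis
  have "1 \<le> 1 - x * t0" using assms t0 by (simp add: mult_le_0_iff)
  then have "(1 - x * t0) powr (- p) \<le> 1" using assms
    by (simp add: powr_minus inverse_le_1_iff ge_one_powr_ge_zero)
  then have "euler_phase p q s x t0 \<le> euler_phase 0 q s x t0"
    using \<open>1 \<le> 1 - x * t0\<close> by (simp add: euler_phase_def mult_left_le)
  also have "\<dots> \<le> euler_peak 0 q s x"
    by (rule euler_phase_le_peak) (use assms t0 in auto)
  finally show ?thesis using t0 by simp
qed

lemma euler_peak_0_less_1:
  assumes "0 < q" "0 < s" "\<bar>x\<bar> < 1"
  shows "euler_peak 0 q s x < 1"
proof -
  obtain t0 where t0: "t0 \<in> {0<..<1}" "euler_peak 0 q s x = euler_phase 0 q s x t0"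
    using euler_phase_unique_max[OF assms] by metis
  have "t0 powr q < 1" "(1 - t0) powr s < 1" using t0 assms powr_less_mono2[of q t0 1] powr_less_mono2[of s "1 - t0" 1] by auto
  then have "t0 powr q * (1 - t0) powr s < 1 * 1"
    using t0 by (intro mult_strict_mono) auto
  then show ?thesis using t0 one_minus_mult_pos[OF assms(3), of t0] by (simp add: euler_phase_def)
qed

text \<open>The maximum sits at q / (q + s). The upper bound is Gibbs' inequality:
  \<open>ln y \<le> y - 1\<close> is applied to the quotients of t and 1 - t by their optimal
  values, and the two linear right-hand sides add up to 0. The result is symmetric in q and s, which
  is used later to cancel two peaks.\<close>

lemma euler_peak_0:
  assumes q: "0 < q" and s: "0 < s" and x: "\<bar>x\<bar> < 1"
  shows "euler_peak 0 q s x = q powr q * s powr s / (q + s) powr (q + s)"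
proof (rule antisym)
  let ?m = "q powr q * s powr s / (q + s) powr (q + s)"
  have m: "?m = exp (q * ln (q / (q + s)) + s * ln (s / (q + s)))"
    using q s by (simp add: powr_def exp_add exp_diff ln_div algebra_simps)
  obtain t where t: "t \<in> {0<..<1}" "euler_peak 0 q s x = euler_phase 0 q s x t"
    using euler_phase_unique_max[OF assms] by metis
  have "q * (ln t - ln (q / (q + s))) = q * ln (t * (q + s) / q)"
    using q s t by (simp add: ln_div ln_mult)
  also have "\<dots> \<le> q * (t * (q + s) / q - 1)"
    using q s t by (intro mult_left_mono ln_le_minus_one) auto
  finally have 1: "q * (ln t - ln (q / (q + s))) \<le> t * (q + s) - q"
    using q by (simp add: right_diff_distrib)
  have "s * (ln (1 - t) - ln (s / (q + s))) = s * ln ((1 - t) * (q + s) / s)"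
    using q s t by (simp add: ln_div ln_mult)
  also have "\<dots> \<le> s * ((1 - t) * (q + s) / s - 1)"
    using q s t by (intro mult_left_mono ln_le_minus_one) auto
  finally have 2: "s * (ln (1 - t) - ln (s / (q + s))) \<le> (1 - t) * (q + s) - s"
    using s by (simp add: right_diff_distrib)
  have "euler_phase 0 q s x t = exp (q * ln t + s * ln (1 - t))"
    using t one_minus_mult_pos[OF x, of t] by (simp add: euler_phase_def powr_def exp_add)
  also have "\<dots> \<le> ?m"
    unfolding m using 1 2 by (simp add: algebra_simps)
  finally show "euler_peak 0 q s x \<le> ?m" using t by simp
  have "?m = euler_phase 0 q s x (q / (q + s))"
  proof -
    have "1 - q / (q + s) = s / (q + s)" using q s by (simp add: field_simps)
    then show ?thesis using q s one_minus_mult_pos[OF x, of "q / (q + s)"]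
      by (simp add: euler_phase_def powr_divide powr_add)
  qed
  also have "\<dots> \<le> euler_peak 0 q s x" by (rule euler_phase_le_peak) (use assms in auto)
  finally show "?m \<le> euler_peak 0 q s x" .
qed

subsection \<open>Euler's integral\<close>

definition euler_integrand :: "complex \<Rightarrow> complex \<Rightarrow> complex \<Rightarrow> real \<Rightarrow> real \<Rightarrow> complex" where
  "euler_integrand A B S x t =
     of_real t powr (B - 1) * of_real (1 - t) powr (S - 1) * of_real (1 - x * t) powr (- A)"

text \<open>S stands for C - B. For A = 0 this is the Beta integral that normalises Euler's formula,
  so one asymptotic statement serves both the numerator and the denominator of that formula.\<close>

definition euler_integral :: "complex \<Rightarrow> complex \<Rightarrow> complex \<Rightarrow> real \<Rightarrow> complex" where
  "euler_integral A B S x = integral {0..1} (euler_integrand A B S x)"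

text \<open>Real parts above 1, rather than above 0, keep the integrand continuous up to the end
  points, so that no improper integrals arise. This is enough because the parameters are always
  shifted by a large n.\<close>

lemma continuous_on_euler_integrand:
  assumes "1 < Re B" "1 < Re S" "\<bar>x\<bar> < 1"
  shows "continuous_on {0..1} (euler_integrand A B S x)"
proof -
  have 1: "0 < 1 - x * t" if "t \<in> {0..1}" for t
    using one_minus_mult_pos[OF assms(3) that] .
  have 2: "complex_of_real (1 - x * t) \<noteq> 0" if "t \<in> {0..1}" for t
    using 1[OF that] by (metis less_irrefl of_real_eq_0_iff)
  have "continuous_on {0..1} (\<lambda>t. complex_of_real t powr (B - 1))"
    using assms by (intro continuous_on_powr_complex continuous_intros) auto
  moreover have "continuous_on {0..1} (\<lambda>t. complex_of_real (1 - t) powr (S - 1))"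
    using assms by (intro continuous_on_powr_complex continuous_intros) auto
  moreover have "continuous_on {0..1} (\<lambda>t. complex_of_real (1 - x * t) powr (- A))"
  proof (intro continuous_on_powr_complex continuous_intros)
    show "{0..1} \<subseteq> {t. 0 \<le> Re (complex_of_real (1 - x * t)) \<or> Im (complex_of_real (1 - x * t)) \<noteq> 0}"
      using 1 by (fastforce intro: less_imp_le)
  qed (use 2 in blast)
  ultimately show ?thesis
    unfolding euler_integrand_def[abs_def] by (intro continuous_on_mult)
qed

lemma euler_integrand_0:
  assumes "\<bar>x\<bar> < 1" "t \<in> {0..1}"
  shows "euler_integrand 0 B S x t = of_real t powr (B - 1) * of_real (1 - t) powr (S - 1)"
proof -
  have "complex_of_real y powr (- 0) = 1" if "0 < y" for y
    using that by simp
  from this[OF one_minus_mult_pos[OF assms]] show ?thesis by (simp only: euler_integrand_def mult_1_right)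
qed

lemma euler_integrand_shift_power:
  assumes "\<bar>x\<bar> < 1" "t \<in> {0..1}"
  shows "euler_integrand A (B + of_nat k) S x t = of_real t ^ k * euler_integrand A B S x t"
proof (cases "t = 0")
  case False
  then have "complex_of_real t powr (B + of_nat k - 1) = of_real t powr (B - 1) * of_real t ^ k"
    using powr_add[of "complex_of_real t" "B - 1" "of_nat k"]
    by (simp add: powr_nat' algebra_simps)
  then show ?thesis by (simp add: euler_integrand_def)
qed (simp add: euler_integrand_def)

text \<open>The fundamental theorem of calculus for t^B (1 - t)^S, which vanishes at both ends; this
  is the recurrence of the Beta function.\<close>

lemma euler_integral_step:
  assumes "1 < Re B" "1 < Re S" "\<bar>x\<bar> < 1"
  shows "(B + S) * euler_integral 0 (B + 1) S x = B * euler_integral 0 B S x"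
proof -
  let ?F = "\<lambda>z::complex. z powr B * (1 - z) powr S"
  let ?h = "\<lambda>t. B * euler_integrand 0 B S x t - (B + S) * euler_integrand 0 (B + 1) S x t"
  have int: "(euler_integrand 0 B' S x) integrable_on {0..1}" if "1 < Re B'" for B'
    by (intro integrable_continuous_real continuous_on_euler_integrand that assms)
  have "(?h has_integral (?F (of_real 1) - ?F (of_real 0))) {0..1}"
  proof (rule fundamental_theorem_of_calculus_interior)
    show "continuous_on {0..1} (\<lambda>t. ?F (of_real t))"
      using assms
      by (intro continuous_on_mult continuous_on_powr_complex continuous_intros) auto
    fix t :: real assume t: "t \<in> {0<..<1}"
    let ?z = "complex_of_real t"
    have z: "?z \<notin> \<real>\<^sub>\<le>\<^sub>0" "1 - ?z \<notin> \<real>\<^sub>\<le>\<^sub>0" "?z \<noteq> 0" "1 - ?z \<noteq> 0"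
      using t by (auto simp: complex_nonpos_Reals_iff)
    have "(?F has_field_derivative
        B * ?z powr (B - 1) * (1 - ?z) powr S - ?z powr B * (S * (1 - ?z) powr (S - 1))) (at ?z)"
      using z by (auto intro!: derivative_eq_intros simp: algebra_simps)
    also have "B * ?z powr (B - 1) * (1 - ?z) powr S - ?z powr B * (S * (1 - ?z) powr (S - 1)) = ?h t"
    proof -
      have e: "?z powr B = ?z * ?z powr (B - 1)" "(1 - ?z) powr S = (1 - ?z) * (1 - ?z) powr (S - 1)"
        using z powr_add[of ?z 1 "B - 1"] powr_add[of "1 - ?z" 1 "S - 1"] by (simp_all add: powr_to_1)
      have t': "t \<in> {0..1}" using t by simp
      have h0: "euler_integrand 0 B S x t = ?z powr (B - 1) * (1 - ?z) powr (S - 1)"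
        by (simp add: euler_integrand_0[OF assms(3) t'])
      have h1: "euler_integrand 0 (B + 1) S x t = ?z * (?z powr (B - 1) * (1 - ?z) powr (S - 1))"
        using euler_integrand_shift_power[OF assms(3) t', of 0 B 1 S] by (simp add: h0)
      show ?thesis unfolding e h0 h1 by (simp add: algebra_simps)
    qed
    finally show "((\<lambda>t. ?F (of_real t)) has_vector_derivative ?h t) (at t)"
      by (rule has_vector_derivative_real_field)
  qed simp
  moreover have "(?h has_integral
      B * euler_integral 0 B S x - (B + S) * euler_integral 0 (B + 1) S x) {0..1}"
    unfolding euler_integral_def
    using int[of B] int[of "B + 1"] assms
    by (intro has_integral_diff has_integral_mult_right integrable_integral) auto
  ultimately have "?F (of_real 1) - ?F (of_real 0)
      = B * euler_integral 0 B S x - (B + S) * euler_integral 0 (B + 1) S x"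
    by (rule has_integral_unique)
  then show ?thesis by simp
qed

lemma euler_integral_pochhammer:
  assumes "1 < Re B" "1 < Re S" "\<bar>x\<bar> < 1"
  shows "pochhammer (B + S) k * euler_integral 0 (B + of_nat k) S x =
         pochhammer B k * euler_integral 0 B S x"
proof (induction k)
  case (Suc k)
  have "(B + of_nat k + S) * euler_integral 0 (B + of_nat k + 1) S x
      = (B + of_nat k) * euler_integral 0 (B + of_nat k) S x"
    using assms by (intro euler_integral_step) auto
  note step = this
  have "pochhammer (B + S) (Suc k) * euler_integral 0 (B + of_nat (Suc k)) S x
      = pochhammer (B + S) k * ((B + of_nat k + S) * euler_integral 0 (B + of_nat k + 1) S x)"
    by (simp add: pochhammer_Suc ac_simps)
  also have "\<dots> = (B + of_nat k) * (pochhammer (B + S) k * euler_integral 0 (B + of_nat k) S x)"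
    unfolding step by (rule mult.left_commute)
  also have "\<dots> = pochhammer B (Suc k) * euler_integral 0 B S x"
    unfolding Suc by (simp add: pochhammer_Suc)
  finally show ?case .
qed simp

lemma pochhammer_series_sums:
  fixes A z :: complex
  assumes "norm z < 1"
  shows "(\<lambda>k. pochhammer A k / fact k * z ^ k) sums (1 - z) powr (- A)"
proof -
  have "(\<lambda>k. ((- A) gchoose k) * (- z) ^ k) sums (1 + - z) powr (- A)"
    by (rule gen_binomial_complex) (use assms in simp)
  moreover have "((- A) gchoose k) * (- z) ^ k = pochhammer A k / fact k * z ^ k" for k
  proof -
    have "(- 1) ^ k * (- z) ^ k = z ^ k" by (simp flip: power_mult_distrib)
    then show ?thesis by (simp add: gbinomial_pochhammer)
  qed
  ultimately show ?thesis by simp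
qed

text \<open>The factor (1 - x t)^(-A) is expanded into its binomial series and integrated term by
  term; \<open>euler_integral_pochhammer\<close> evaluates the moments. The condition
  \<open>nz\<close> is supplied for large parameters by
  \<open>euler_integral_asymptotics\<close>.\<close>

lemma gauss_2F1_euler_integral:
  assumes "1 < Re B" "1 < Re S" "\<bar>x\<bar> < 1" and nz: "euler_integral 0 B S x \<noteq> 0"
  shows "gauss_2F1 A B (B + S) (of_real x) = euler_integral A B S x / euler_integral 0 B S x"
proof -
  define c where "c k = pochhammer A k / fact k * of_real x ^ k" for k
  let ?h = "euler_integrand 0 B S x"
  let ?f = "\<lambda>k t. c k * (of_real t ^ k * ?h t)"
  have cont_h: "continuous_on {0..1} ?h"
    by (intro continuous_on_euler_integrand assms)
  obtain H where H: "\<And>t. t \<in> {0..1} \<Longrightarrow> norm (?h t) \<le> H"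
  proof -
    have "compact (?h ` {0..1})" by (intro compact_continuous_image cont_h) auto
    then show ?thesis using that by (metis bounded_iff compact_imp_bounded imageI)
  qed
  have "summable (\<lambda>k. norm (c k))"
    unfolding c_def
  \<comment> \<open>Convergence at a radius strictly between |x| and 1 gives absolute convergence at
    x.\<close>
  proof (rule powser_insidea[of "\<lambda>k. pochhammer A k / fact k" "of_real ((1 + \<bar>x\<bar>) / 2)"])
    show "summable (\<lambda>k. pochhammer A k / fact k * complex_of_real ((1 + \<bar>x\<bar>) / 2) ^ k)"
      using assms(3) by (intro sums_summable[OF pochhammer_series_sums])
        (simp only: norm_of_real, simp)
    show "norm (complex_of_real x) < norm (complex_of_real ((1 + \<bar>x\<bar>) / 2))"
      using assms(3) by (simp only: norm_of_real, simp)
  qed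
  then have summ: "summable (\<lambda>k. norm (c k) * H)" by (rule summable_mult2)
  have bound: "norm (?f k t) \<le> norm (c k) * H" if "t \<in> {0..1}" for k t
  proof -
    have "norm (complex_of_real t ^ k * ?h t) \<le> 1 * H"
      unfolding norm_mult using that H[OF that]
      by (intro mult_mono) (auto simp: norm_power power_le_one)
    then show ?thesis by (simp add: norm_mult mult_left_mono)
  qed
  have lim: "uniform_limit {0..1} (\<lambda>n t. \<Sum>k<n. ?f k t) (\<lambda>t. \<Sum>k. ?f k t) sequentially"
    by (rule Weierstrass_m_test[OF bound summ])
  have sum_eq: "(\<Sum>k. ?f k t) = euler_integrand A B S x t" if t: "t \<in> {0..1}" for t
  proof -
    have "norm (complex_of_real (x * t)) < 1"
    proof -
      have "\<bar>x\<bar> * t \<le> \<bar>x\<bar> * 1" using t by (intro mult_left_mono) auto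
      then show ?thesis using assms(3) t by (simp only: norm_of_real) (simp add: abs_mult)
    qed
    from sums_mult2[OF pochhammer_series_sums[OF this, of A], of "?h t"]
    have "(\<lambda>k. ?f k t) sums ((1 - of_real (x * t)) powr (- A) * ?h t)"
      by (simp add: c_def power_mult_distrib mult_ac)
    also have "(1 - of_real (x * t)) powr (- A) * ?h t = euler_integrand A B S x t"
      unfolding euler_integrand_0[OF assms(3) t] by (simp add: euler_integrand_def)
    finally show ?thesis by (rule sums_unique[symmetric])
  qed
  obtain I J where IJ: "\<And>n. ((\<lambda>t. \<Sum>k<n. ?f k t) has_integral I n) {0..1}"
      "((\<lambda>t. \<Sum>k. ?f k t) has_integral J) {0..1}" "I \<longlonglongrightarrow> J"
  proof (rule uniform_limit_integral[OF lim])
    show "continuous_on {0..1} (\<lambda>t. \<Sum>k<n. ?f k t)" for n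
      by (intro continuous_intros cont_h)
  qed auto
  have J: "J = euler_integral A B S x"
  proof -
    have "(euler_integrand A B S x has_integral J) {0..1}"
      using IJ(2) sum_eq has_integral_cong[of "{0..1}" "\<lambda>t. \<Sum>k. ?f k t" "euler_integrand A B S x"] by blast
    then show ?thesis unfolding euler_integral_def by (rule integral_unique[symmetric])
  qed
  define T where "T k = pochhammer A k * pochhammer B k / (pochhammer (B + S) k * fact k) * of_real x ^ k"
    for k
  have I: "I n = (\<Sum>k<n. T k) * euler_integral 0 B S x" for n
  proof -
    have "((\<lambda>t. \<Sum>k<n. ?f k t) has_integral (\<Sum>k<n. T k * euler_integral 0 B S x)) {0..1}"
    proof (rule has_integral_sum)
      fix k
      have "((\<lambda>t. c k * euler_integrand 0 (B + of_nat k) S x t) has_integral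
              c k * euler_integral 0 (B + of_nat k) S x) {0..1}"
        unfolding euler_integral_def using assms
        by (intro has_integral_mult_right integrable_integral integrable_continuous_real
              continuous_on_euler_integrand) auto
      moreover have "pochhammer (B + S) k \<noteq> 0"
      proof
        assume "pochhammer (B + S) k = 0"
        then obtain j where "B + S = - of_nat j" by (auto simp: pochhammer_eq_0_iff)
        then have "Re (B + S) = - real j" by simp
        with assms show False by simp
      qed
      then have "c k * euler_integral 0 (B + of_nat k) S x = T k * euler_integral 0 B S x"
        using euler_integral_pochhammer[OF assms(1-3), of k] by (simp add: c_def T_def field_simps)
      ultimately have "((\<lambda>t. c k * euler_integrand 0 (B + of_nat k) S x t) has_integral
              T k * euler_integral 0 B S x) {0..1}" by simp
      then show "(?f k has_integral T k * euler_integral 0 B S x) {0..1}"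
        using has_integral_cong[of "{0..1}" "\<lambda>t. c k * euler_integrand 0 (B + of_nat k) S x t" "?f k"]
          euler_integrand_shift_power[OF assms(3)] by (metis (no_types, lifting))
    qed simp
    from has_integral_unique[OF IJ(1) this] show ?thesis by (simp add: sum_distrib_right)
  qed
  have "(\<lambda>n. \<Sum>k<n. T k) \<longlonglongrightarrow> J / euler_integral 0 B S x"
    using tendsto_divide[OF IJ(3) tendsto_const nz] nz by (simp add: I)
  then have "T sums (J / euler_integral 0 B S x)" by (simp add: sums_def)
  then show ?thesis unfolding gauss_2F1_def J T_def by (rule sums_unique[symmetric])
qed

section \<open>Growth of Euler's integral and of the Gauss function along arithmetic
  progressions\<close>

lemma euler_integrand_scale:
  assumes "\<bar>x\<bar> < 1" "t \<in> {0..1}" "1 < Re B" "1 < Re S" "0 < q" "0 < s"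
  shows "euler_integrand (A + of_real p * of_nat n) (B + of_real q * of_nat n) (S + of_real s * of_nat n) x t
    = of_real (euler_phase p q s x t ^ n) * euler_integrand A B S x t"
proof (cases "t = 0 \<or> t = 1")
  case False
  have pow: "complex_of_real y powr (C + of_real c * of_nat n) = of_real (y powr c) ^ n * of_real y powr C"
    if "0 < y" for y c C
  proof -
    have "complex_of_real y powr (C + of_real c * of_nat n)
        = of_real y powr C * of_real y powr (of_real (c * real n))"
      using that by (simp add: powr_add)
    also have "of_real y powr (of_real (c * real n)) = complex_of_real (y powr (c * real n))"
      using that by (intro powr_of_real) auto
    also have "y powr (c * real n) = (y powr c) ^ n"
      using that by (simp add: powr_powr[symmetric] powr_realpow)
    finally show ?thesis by simp
  qed
  have pos: "0 < t" "0 < 1 - t" "0 < 1 - x * t"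
    using False assms(2) one_minus_mult_pos[OF assms(1,2)] by auto
  show ?thesis
    using pow[OF pos(1), of "B - 1" q] pow[OF pos(2), of "S - 1" s] pow[OF pos(3), of "- A" "- p"]
    unfolding euler_integrand_def euler_phase_def
    by (simp add: power_mult_distrib algebra_simps)
next
  \<comment> \<open>At the end points both sides vanish, by the convention
    \<open>0 powr z = 0\<close>.\<close>
  case True
  then show ?thesis by (auto simp: euler_integrand_def)
qed

text \<open>Consecutive integrals differ only by one factor \<open>\<Phi>\<close> in the integrand.
  Measured against the same integral of \<open>\<Phi> ^ n\<close>, they converge to g(t0) and
  \<Phi>(t0) g(t0), and the quotient of these limits is the peak.\<close>

lemma euler_integral_asymptotics:
  fixes A B S :: complex and p q s x :: real
  assumes x: "\<bar>x\<bar> < 1" and q: "0 < q" and s: "0 < s"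
  defines "X \<equiv> \<lambda>n. euler_integral (A + of_real p * of_nat n) (B + of_real q * of_nat n) (S + of_real s * of_nat n) x"
  shows "eventually (\<lambda>n. X n \<noteq> 0) sequentially"
    and "(\<lambda>n. X (Suc n) / X n) \<longlonglongrightarrow> of_real (euler_peak p q s x)"
proof -
  let ?\<Phi> = "euler_phase p q s x"
  obtain t0 where t0: "t0 \<in> {0<..<1}" "euler_peak p q s x = ?\<Phi> t0"
    "\<And>t. t \<in> {0..1} \<Longrightarrow> t \<noteq> t0 \<Longrightarrow> ?\<Phi> t < ?\<Phi> t0"
    using euler_phase_unique_max[OF q s x] by metis
  have t0': "t0 \<in> {0..1}" using t0 by simp
  obtain N1 :: nat where N1: "(1 - Re B) / q < N1" using reals_Archimedean2 by blast
  obtain N2 :: nat where N2: "(1 - Re S) / s < N2" using reals_Archimedean2 by blast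
  \<comment> \<open>After N steps both exponents have real part above 1, and the rest of the
    integrand becomes a continuous weight g.\<close>
  define N where "N = max N1 N2"
  have "(1 - Re B) / q < N" "(1 - Re S) / s < N" using N1 N2 by (auto simp: N_def)
  then have N: "1 < Re (B + of_real q * of_nat N)" "1 < Re (S + of_real s * of_nat N)"
    using q s by (simp_all add: field_simps)
  define g where "g = euler_integrand (A + of_real p * of_nat N) (B + of_real q * of_nat N)
                        (S + of_real s * of_nat N) x"
  have cont_g: "continuous_on {0..1} g"
    unfolding g_def by (rule continuous_on_euler_integrand[OF N x])
  note cont = continuous_on_euler_phase[OF q s x, of p]
  define c where "c n = complex_of_real (integral {0..1} (\<lambda>t. ?\<Phi> t ^ n))" for n
  have c: "c n \<noteq> 0" for n
    using integral_power_pos[OF cont euler_phase_nonneg t0' euler_phase_pos[OF x t0(1)], of n]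
    by (simp add: c_def)
  have XN: "X (n + N) = integral {0..1} (\<lambda>t. of_real (?\<Phi> t ^ n) * g t)" for n
    unfolding X_def euler_integral_def
  proof (rule integral_cong)
    fix t :: real assume "t \<in> {0..1}"
    from euler_integrand_scale[OF x this N q s, of "A + of_real p * of_nat N" p n]
    show "euler_integrand (A + of_real p * of_nat (n + N)) (B + of_real q * of_nat (n + N))
        (S + of_real s * of_nat (n + N)) x t = of_real (?\<Phi> t ^ n) * g t"
      by (simp add: g_def algebra_simps)
  qed
  have gt0: "g t0 \<noteq> 0"
  proof -
    have "t0 \<noteq> 0" "1 - t0 \<noteq> 0" "1 - x * t0 \<noteq> 0"
      using t0(1) one_minus_mult_pos[OF x t0'] by auto
    then show ?thesis
      unfolding g_def euler_integrand_def mult_eq_0_iff powr_eq_0_iff of_real_eq_0_iff by blast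
  qed
  have lim1: "(\<lambda>n. X (n + N) / c n) \<longlonglongrightarrow> g t0"
    unfolding XN c_def
    by (rule laplace_concentration[OF cont euler_phase_nonneg t0' t0(3) cont_g])
  have lim2: "(\<lambda>n. X (Suc n + N) / c n) \<longlonglongrightarrow> of_real (?\<Phi> t0) * g t0"
  proof -
    have "continuous_on {0..1} (\<lambda>t. of_real (?\<Phi> t) * g t)"
      by (intro continuous_intros cont cont_g)
    from laplace_concentration[OF cont euler_phase_nonneg t0' t0(3) this]
    show ?thesis unfolding XN c_def by (simp add: mult_ac)
  qed
  have "eventually (\<lambda>n. X (n + N) / c n \<noteq> 0) sequentially"
    using lim1 gt0 by (rule tendsto_imp_eventually_ne)
  then have "eventually (\<lambda>n. X (n + N) \<noteq> 0) sequentially"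
    by eventually_elim auto
  then show "eventually (\<lambda>n. X n \<noteq> 0) sequentially"
    by (rule eventually_sequentially_seg[of "\<lambda>n. X n \<noteq> 0" N, THEN iffD1])
  have "(\<lambda>n. (X (Suc (n + N)) / c n) / (X (n + N) / c n)) \<longlonglongrightarrow> of_real (?\<Phi> t0) * g t0 / g t0"
    by (rule tendsto_divide[OF lim2[unfolded add_Suc] lim1 gt0])
  moreover have "(X (Suc (n + N)) / c n) / (X (n + N) / c n) = X (Suc (n + N)) / X (n + N)" for n
    using c[of n] by (simp add: field_simps)
  ultimately have "(\<lambda>n. X (Suc (n + N)) / X (n + N)) \<longlonglongrightarrow> of_real (euler_peak p q s x)"
    using gt0 t0(2) by (simp only: nonzero_mult_div_cancel_right not_False_eq_True)
  then show "(\<lambda>n. X (Suc n) / X n) \<longlonglongrightarrow> of_real (euler_peak p q s x)"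
    by (rule LIMSEQ_offset)
qed

lemma eventually_linear_gt:
  fixes c C :: real
  assumes "0 < c"
  shows "eventually (\<lambda>k. 0 < C + c * real k) sequentially"
proof -
  have "filterlim (\<lambda>k. c * real k) at_top sequentially"
    using assms by (intro filterlim_tendsto_pos_mult_at_top[OF tendsto_const _ filterlim_real_sequentially])
  then have "eventually (\<lambda>k. - C < c * real k) sequentially"
    by (simp add: filterlim_at_top_dense)
  then show ?thesis by eventually_elim simp
qed

lemma gauss_2F1_asymptotics:
  fixes A B C :: complex and p q r x :: real
  assumes x: "\<bar>x\<bar> < 1" and q: "0 < q" "q < r"
  defines "F \<equiv> \<lambda>n. gauss_2F1 (A + of_real p * of_nat n) (B + of_real q * of_nat n)
                     (C + of_real r * of_nat n) (of_real x)"
  shows "eventually (\<lambda>n. F n \<noteq> 0) sequentially"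
    and "(\<lambda>n. F (Suc n) / F n) \<longlonglongrightarrow>
           of_real (euler_peak p q (r - q) x / euler_peak 0 q (r - q) x)"
proof -
  define s where "s = r - q"
  have s: "0 < s" using q by (simp add: s_def)
  define X where "X n = euler_integral (A + of_real p * of_nat n) (B + of_real q * of_nat n)
      (C - B + of_real s * of_nat n) x" for n
  \<comment> \<open>The Beta integral in the denominator of Euler's formula; its first parameter 0
    is written as a progression with step 0 to match the asymptotics lemma.\<close>
  define Y where "Y n = euler_integral (0 + of_real 0 * of_nat n) (B + of_real q * of_nat n)
      (C - B + of_real s * of_nat n) x" for n
  note asX = euler_integral_asymptotics[OF x q(1) s, of A p B "C - B", folded X_def]
  note asY = euler_integral_asymptotics[OF x q(1) s, of 0 0 B "C - B", folded Y_def]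
  have evRe: "eventually (\<lambda>n. 1 < Re (D + of_real c * of_nat n)) sequentially" if "0 < c" for D c
    using eventually_linear_gt[OF that, of "Re D - 1"] by eventually_elim simp
  have "eventually (\<lambda>n. F n = X n / Y n) sequentially"
    using evRe[OF q(1), of B] evRe[OF s, of "C - B"] asY(1)
  proof eventually_elim
    case (elim n)
    from gauss_2F1_euler_integral[OF elim(1,2) x, of "A + of_real p * of_nat n"] elim(3)
    show ?case by (simp add: F_def X_def Y_def s_def algebra_simps)
  qed
  note F = this
  show "eventually (\<lambda>n. F n \<noteq> 0) sequentially"
    using F asX(1) asY(1) by eventually_elim simp
  have "(\<lambda>n. (X (Suc n) / X n) / (Y (Suc n) / Y n)) \<longlonglongrightarrow>
      of_real (euler_peak p q s x) / of_real (euler_peak 0 q s x)"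
    using euler_peak_pos[OF q(1) s x, of 0] by (intro tendsto_divide asX asY) auto
  moreover have "eventually (\<lambda>n. (X (Suc n) / X n) / (Y (Suc n) / Y n) = F (Suc n) / F n) sequentially"
    using F eventually_sequentially_Suc[THEN iffD2, OF F]
    by eventually_elim (simp add: field_simps)
  ultimately show "(\<lambda>n. F (Suc n) / F n) \<longlonglongrightarrow>
           of_real (euler_peak p q (r - q) x / euler_peak 0 q (r - q) x)"
    by (simp add: Lim_transform_eventually s_def)
qed

subsection \<open>The regularised hypergeometric function\<close>

text \<open>The series of 2F1 divided by Gamma(C). As (C)_k Gamma(C) = Gamma(C + k), the division
  removes the poles at C = 0, -1, -2, ...\<close>

definition reg_2F1_term :: "complex \<Rightarrow> complex \<Rightarrow> complex \<Rightarrow> complex \<Rightarrow> nat \<Rightarrow> complex" where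
  "reg_2F1_term A B C x k = pochhammer A k * pochhammer B k * rGamma (C + of_nat k) / fact k * x ^ k"

definition reg_2F1 :: "complex \<Rightarrow> complex \<Rightarrow> complex \<Rightarrow> complex \<Rightarrow> complex" where
  "reg_2F1 A B C x = (\<Sum>k. reg_2F1_term A B C x k)"

text \<open>Stated without division, because \<open>C + of_nat k\<close> may vanish.\<close>

lemma reg_2F1_term_Suc:
  "(C + of_nat k) * of_nat (Suc k) * reg_2F1_term A B C x (Suc k) =
     (A + of_nat k) * (B + of_nat k) * x * reg_2F1_term A B C x k"
proof -
  have "rGamma (C + of_nat k) = (C + of_nat k) * rGamma (C + of_nat (Suc k))"
    using rGamma_plus1[of "C + of_nat k"] by (simp add: add_ac)
  then show ?thesis
    by (simp add: reg_2F1_term_def pochhammer_Suc field_simps del: of_nat_Suc)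
qed

text \<open>N and y depend only on x and the bound \<open>\<rho>\<close> on the parameters. This
  uniformity yields a common geometric majorant on discs, as needed in
  \<open>holomorphic_reg_2F1\<close>.\<close>

lemma reg_2F1_term_ratio_bound:
  fixes x :: complex
  assumes "norm x < 1"
  obtains y N where "0 < y" "y < 1"
    "\<And>k A B C. N \<le> k \<Longrightarrow> norm A \<le> \<rho> \<Longrightarrow> norm B \<le> \<rho> \<Longrightarrow> norm C \<le> \<rho> \<Longrightarrow>
       norm (reg_2F1_term A B C x (Suc k)) \<le> y * norm (reg_2F1_term A B C x k)"
proof -
  define y where "y = (1 + norm x) / 2"
  have y: "0 < y" "y < 1" "norm x < y"
    using assms by (auto simp: y_def add_pos_nonneg)
  have "((\<lambda>k::nat. (real k + \<rho>)\<^sup>2 * norm x / ((real k - \<rho>) * real (Suc k))) \<longlongrightarrow> norm x) sequentially"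
    by real_asymp
  then have "eventually (\<lambda>k. (real k + \<rho>)\<^sup>2 * norm x / ((real k - \<rho>) * real (Suc k)) < y) sequentially"
    using y(3) by (rule order_tendstoD)
  moreover have "eventually (\<lambda>k. \<rho> < real k) sequentially"
    by real_asymp
  ultimately have "eventually (\<lambda>k. \<rho> < real k \<and>
      (real k + \<rho>)\<^sup>2 * norm x / ((real k - \<rho>) * real (Suc k)) < y) sequentially"
    by eventually_elim simp
  then obtain N where N: "\<And>k. N \<le> k \<Longrightarrow> \<rho> < real k \<and>
      (real k + \<rho>)\<^sup>2 * norm x / ((real k - \<rho>) * real (Suc k)) < y"
    unfolding eventually_sequentially by blast
  show thesis
  proof (rule that[OF y(1,2)])
    fix k A B C
    assume k: "N \<le> k" and ABC: "norm (A::complex) \<le> \<rho>" "norm (B::complex) \<le> \<rho>" "norm (C::complex) \<le> \<rho>"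
    have pos: "0 < (real k - \<rho>) * real (Suc k)" using N[OF k] by simp
    have le: "(real k + \<rho>)\<^sup>2 * norm x \<le> y * ((real k - \<rho>) * real (Suc k))"
      using N[OF k] pos by (simp add: pos_divide_less_eq del: of_nat_Suc)
    have "real k - \<rho> \<le> norm (of_nat k :: complex) - norm C" using ABC by simp
    also have "\<dots> \<le> norm (C + of_nat k)" by (metis add.commute norm_diff_ineq)
    finally have 1: "real k - \<rho> \<le> norm (C + of_nat k)" .
    have "norm (A + of_nat k) \<le> real k + \<rho>" "norm (B + of_nat k) \<le> real k + \<rho>"
      using ABC norm_triangle_ineq[of A "of_nat k"] norm_triangle_ineq[of B "of_nat k"] by auto
    then have 2: "norm (A + of_nat k) * norm (B + of_nat k) \<le> (real k + \<rho>)\<^sup>2"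
      unfolding power2_eq_square using norm_ge_zero order_trans by (intro mult_mono) blast+
    let ?T = "\<lambda>k. norm (reg_2F1_term A B C x k)"
    have "(real k - \<rho>) * real (Suc k) * ?T (Suc k) \<le> norm (C + of_nat k) * real (Suc k) * ?T (Suc k)"
      using 1 by (intro mult_right_mono) auto
    also have "\<dots> = norm ((A + of_nat k) * (B + of_nat k) * x * reg_2F1_term A B C x k)"
      unfolding reg_2F1_term_Suc[symmetric] by (simp add: norm_mult del: of_nat_Suc)
    also have "\<dots> = norm (A + of_nat k) * norm (B + of_nat k) * (norm x * ?T k)"
      by (simp add: norm_mult)
    also have "\<dots> \<le> (real k + \<rho>)\<^sup>2 * (norm x * ?T k)"
      using 2 by (intro mult_right_mono) auto
    also have "\<dots> \<le> y * ((real k - \<rho>) * real (Suc k)) * ?T k"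
      using le by (simp only: mult.assoc[symmetric]) (intro mult_right_mono, auto)
    finally have "((real k - \<rho>) * real (Suc k)) * ?T (Suc k) \<le> ((real k - \<rho>) * real (Suc k)) * (y * ?T k)"
      by (simp only: mult_ac)
    then show "?T (Suc k) \<le> y * ?T k" using pos by (simp only: mult_le_cancel_left_pos)
  qed
qed

lemma summable_reg_2F1:
  assumes "norm x < 1"
  shows "summable (reg_2F1_term A B C x)"
proof -
  obtain y N where "0 < y" "y < 1"
    and le: "\<And>k A' B' C'. N \<le> k \<Longrightarrow> norm A' \<le> Max {norm A, norm B, norm C} \<Longrightarrow>
       norm B' \<le> Max {norm A, norm B, norm C} \<Longrightarrow> norm C' \<le> Max {norm A, norm B, norm C} \<Longrightarrow>
       norm (reg_2F1_term A' B' C' x (Suc k)) \<le> y * norm (reg_2F1_term A' B' C' x k)"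
    using reg_2F1_term_ratio_bound[OF assms] by blast
  show ?thesis
    by (rule summable_ratio_test[OF \<open>y < 1\<close>, of N]) (auto intro!: le)
qed

lemma holomorphic_reg_2F1:
  assumes x: "norm x < 1"
    and hol: "A holomorphic_on UNIV" "B holomorphic_on UNIV" "C holomorphic_on UNIV"
  shows "(\<lambda>w. reg_2F1 (A w) (B w) (C w) x) holomorphic_on UNIV"
proof (rule holomorphic_uniform_sequence[OF open_UNIV])
  let ?T = "\<lambda>k w. reg_2F1_term (A w) (B w) (C w) x k"
  have term_hol: "?T k holomorphic_on UNIV" for k
  proof -
    have "(\<lambda>w. pochhammer (F w) k) holomorphic_on UNIV" if "F holomorphic_on UNIV" for F
      unfolding pochhammer_prod using that by (intro holomorphic_intros)
    then show ?thesis
      unfolding reg_2F1_term_def using hol by (intro holomorphic_intros) auto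
  qed
  then show "(\<lambda>w. \<Sum>k<n. ?T k w) holomorphic_on UNIV" for n
    by (intro holomorphic_intros)
  fix z :: complex
  have bdd: "\<exists>M. \<forall>w\<in>cball z 1. norm (F w) \<le> M" if "F holomorphic_on UNIV" for F :: "complex \<Rightarrow> complex"
  proof -
    have "compact (F ` cball z 1)"
      using that by (intro compact_continuous_image holomorphic_on_imp_continuous_on)
        (auto intro: holomorphic_on_subset)
    then show ?thesis by (metis bounded_iff compact_imp_bounded imageI)
  qed
  obtain M1 M2 M3 where M: "\<And>w. w \<in> cball z 1 \<Longrightarrow> norm (A w) \<le> M1"
      "\<And>w. w \<in> cball z 1 \<Longrightarrow> norm (B w) \<le> M2" "\<And>w. w \<in> cball z 1 \<Longrightarrow> norm (C w) \<le> M3"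
    using bdd hol by meson
  define \<rho> where "\<rho> = max M1 (max M2 M3)"
  have \<rho>: "norm (A w) \<le> \<rho>" "norm (B w) \<le> \<rho>" "norm (C w) \<le> \<rho>" if "w \<in> cball z 1" for w
    using M[OF that] by (auto simp: \<rho>_def)
  obtain y N where y: "0 < y" "y < 1" and
    step: "\<And>k A B C. N \<le> k \<Longrightarrow> norm A \<le> \<rho> \<Longrightarrow> norm B \<le> \<rho> \<Longrightarrow> norm C \<le> \<rho> \<Longrightarrow>
       norm (reg_2F1_term A B C x (Suc k)) \<le> y * norm (reg_2F1_term A B C x k)"
    using reg_2F1_term_ratio_bound[OF x] by blast
  obtain K where K: "\<And>w. w \<in> cball z 1 \<Longrightarrow> norm (?T N w) \<le> K"
    using bdd[OF term_hol[of N]] by blast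
  have bound: "norm (?T (N + j) w) \<le> K * y ^ j" if w: "w \<in> cball z 1" for w j
  proof (induction j)
    case 0
    then show ?case using K[OF w] by simp
  next
    case (Suc j)
    have "norm (?T (N + Suc j) w) \<le> y * norm (?T (N + j) w)"
      using step[of "N + j" "A w" "B w" "C w"] \<rho>[OF w] by simp
    also have "\<dots> \<le> y * (K * y ^ j)" using Suc y by (intro mult_left_mono) auto
    finally show ?case by (simp add: mult_ac)
  qed
  have "uniform_limit (cball z 1) (\<lambda>n w. \<Sum>k<n. ?T k w) (\<lambda>w. \<Sum>k. ?T k w) sequentially"
  proof (rule Weierstrass_m_test_ev)
    show "summable (\<lambda>k. K / y ^ N * y ^ k)"
      using y by (intro summable_mult summable_geometric) auto
    show "\<forall>\<^sub>F k in sequentially. \<forall>w\<in>cball z 1. norm (?T k w) \<le> K / y ^ N * y ^ k"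
      unfolding eventually_sequentially
    proof (intro exI allI impI ballI)
      fix k w assume "N \<le> k" "w \<in> cball z 1"
      then show "norm (?T k w) \<le> K / y ^ N * y ^ k"
        using bound[of w "k - N"] y by (simp add: power_diff)
    qed
  qed
  then show "\<exists>d. 0 < d \<and> cball z d \<subseteq> UNIV \<and>
      uniform_limit (cball z d) (\<lambda>n w. \<Sum>k<n. ?T k w) (\<lambda>w. reg_2F1 (A w) (B w) (C w) x) sequentially"
    unfolding reg_2F1_def by (intro exI[of _ 1]) auto
qed

lemma gauss_2F1_sums:
  assumes "norm x < 1" "rGamma C \<noteq> 0"
  shows "(\<lambda>k. pochhammer A k * pochhammer B k / (pochhammer C k * fact k) * x ^ k) sums
           (reg_2F1 A B C x / rGamma C)"
proof -
  have "(\<lambda>k. reg_2F1_term A B C x k / rGamma C) sums (reg_2F1 A B C x / rGamma C)"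
    unfolding reg_2F1_def by (intro sums_divide summable_sums summable_reg_2F1 assms)
  moreover have "reg_2F1_term A B C x k / rGamma C =
      pochhammer A k * pochhammer B k / (pochhammer C k * fact k) * x ^ k" for k
  proof -
    have "rGamma C = pochhammer C k * rGamma (C + of_nat k)" by (rule pochhammer_rGamma)
    then show ?thesis using assms(2) by (simp add: reg_2F1_term_def mult_ac)
  qed
  ultimately show ?thesis by simp
qed

lemma gauss_2F1_times_rGamma:
  assumes "norm x < 1" "rGamma C \<noteq> 0"
  shows "gauss_2F1 A B C x * rGamma C = reg_2F1 A B C x"
proof -
  have "gauss_2F1 A B C x = reg_2F1 A B C x / rGamma C"
    unfolding gauss_2F1_def by (rule sums_unique[OF gauss_2F1_sums[OF assms], symmetric])
  then show ?thesis using assms(2) by simp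
qed

text \<open>At C = -n the reciprocal Gamma factor kills the terms with index at most n, and the
  remaining ones form a Gauss series again. These are the numerators of the residues of f.\<close>

lemma reg_2F1_minus_of_nat:
  assumes "norm x < 1"
  shows "reg_2F1 A B (- of_nat n) x =
    pochhammer A (Suc n) * pochhammer B (Suc n) / fact (Suc n) * x ^ Suc n *
    gauss_2F1 (A + of_nat (Suc n)) (B + of_nat (Suc n)) (of_nat (n + 2)) x"
proof -
  let ?T = "reg_2F1_term A B (- of_nat n) x"
  let ?c = "pochhammer A (Suc n) * pochhammer B (Suc n) / fact (Suc n) * x ^ Suc n"
  let ?g = "\<lambda>j. pochhammer (A + of_nat (Suc n)) j * pochhammer (B + of_nat (Suc n)) j /
                 (pochhammer (of_nat (n + 2)) j * fact j) * x ^ j"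
  have zero: "?T k = 0" if "k < Suc n" for k
  proof -
    have "- complex_of_nat n + of_nat k = - of_nat (n - k)" using that by (simp add: of_nat_diff)
    then have "rGamma (- complex_of_nat n + of_nat k) = 0"
      by (simp only: rGamma_eq_zero_iff minus_of_nat_in_nonpos_Ints)
    then show ?thesis by (simp add: reg_2F1_term_def)
  qed
  have shift: "?T (j + Suc n) = ?c * ?g j" for j
  proof -
    have 1: "rGamma (- complex_of_nat n + of_nat (j + Suc n)) = 1 / fact j"
    proof -
      have "- complex_of_nat n + of_nat (j + Suc n) = of_nat (Suc j)" by simp
      then show ?thesis using rGamma_of_int[of "int (Suc j)", where 'a = complex]
        by (simp add: field_simps)
    qed
    have 2: "fact (j + Suc n) = (fact (Suc n) * pochhammer (of_nat (n + 2)) j :: complex)"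
      using pochhammer_product'[of "1::complex" "Suc n" j]
      by (simp add: pochhammer_fact add_ac)
    have 3: "pochhammer D (j + Suc n) = pochhammer D (Suc n) * pochhammer (D + of_nat (Suc n)) j" for D :: complex
      using pochhammer_product'[of D "Suc n" j] by (simp add: add_ac)
    show ?thesis
      unfolding reg_2F1_term_def 1 2 3 power_add by (simp add: field_simps del: fact_Suc of_nat_Suc pochhammer_Suc)
  qed
  have nz: "rGamma (of_nat (n + 2) :: complex) \<noteq> 0"
    using rGamma_of_int[of "int (n + 2)", where 'a = complex] by simp
  have "reg_2F1 A B (- of_nat n) x = (\<Sum>j. ?T (j + Suc n)) + (\<Sum>k<Suc n. ?T k)"
    unfolding reg_2F1_def by (rule suminf_split_initial_segment[OF summable_reg_2F1[OF assms]])
  also have "(\<Sum>k<Suc n. ?T k) = 0" using zero by (intro sum.neutral) auto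
  also have "(\<Sum>j. ?T (j + Suc n)) = ?c * (\<Sum>j. ?g j)"
    unfolding shift
    by (rule suminf_mult[OF sums_summable[OF gauss_2F1_sums[OF assms nz]]])
  finally show ?thesis by (simp only: gauss_2F1_def add_0_right)
qed

subsection \<open>Products of sines with convergent ratios\<close>

lemma cos_two_step:
  "cos (a + b * real (k + 2)) = 2 * cos b * cos (a + b * real (k + 1)) - cos (a + b * real k)"
proof -
  have step: "cos (y + b) = 2 * cos b * cos y - cos (y - b)" for y
    using cos_add[of y b] cos_diff[of y b] by (simp add: algebra_simps)
  have "a + b * real (k + 1) + b = a + b * real (k + 2)"
    by (simp add: distrib_left)
  moreover have "a + b * real (k + 1) - b = a + b * real k"
    by (simp add: distrib_left)
  ultimately show ?thesis using step[of "a + b * real (k + 1)"] by (simp only:)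
qed

text \<open>With \<open>(E f) k = f (k + 1)\<close>, both cosines are annihilated by a factor of
  \<open>(E\<^sup>2 - 2 c E + 1) (E\<^sup>2 - 2 c' E + 1)\<close>.\<close>

lemma cos_difference_recurrence:
  fixes f :: "nat \<Rightarrow> real"
  assumes "\<And>k. f k = cos (a + b * real k) - cos (a' + b' * real k)"
  defines "c \<equiv> cos b" and "c' \<equiv> cos b'"
  shows "f (k + 4) + (- 2 * (c + c')) * f (k + 3) + (2 + 4 * (c * c')) * f (k + 2)
           + (- 2 * (c + c')) * f (k + 1) + f k = 0"
proof -
  have step: "u (k + 4) - 2 * (c + c') * u (k + 3) + (2 + 4 * (c * c')) * u (k + 2)
           - 2 * (c + c') * u (k + 1) + u k = 0"
    if u: "\<forall>j. u (j + 2) = 2 * e * u (j + 1) - u j"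
      and sym: "c + c' = e + e'" "c * c' = e * e'"
    for u :: "nat \<Rightarrow> real" and e e'
  proof -
    have u1: "u (k + 4) = 2 * e * u (k + 3) - u (k + 2)" "u (k + 3) = 2 * e * u (k + 2) - u (k + 1)"
      "u k = 2 * e * u (k + 1) - u (k + 2)"
      using u[rule_format, of "k + 2"] u[rule_format, of "k + 1"] u[rule_format, of k]
      by (simp_all add: numeral_eq_Suc)
    show ?thesis unfolding sym u1 by (simp add: algebra_simps)
  qed
  have 1: "\<forall>j. cos (a + b * real (j + 2)) = 2 * c * cos (a + b * real (j + 1)) - cos (a + b * real j)"
    unfolding c_def by (intro allI cos_two_step)
  have 2: "\<forall>j. cos (a' + b' * real (j + 2)) = 2 * c' * cos (a' + b' * real (j + 1)) - cos (a' + b' * real j)"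
    unfolding c'_def by (intro allI cos_two_step)
  show ?thesis
    using step[OF 1 refl refl] step[OF 2 add.commute mult.commute]
    unfolding assms(1) by (simp add: algebra_simps)
qed

text \<open>Since f (k + j) / f k tends to L^j, dividing the recurrence by f k and passing to the
  limit gives its characteristic equation at L.\<close>

lemma ratio_limit_is_root:
  fixes f :: "nat \<Rightarrow> real"
  assumes nz: "eventually (\<lambda>k. f k \<noteq> 0) sequentially"
    and lim: "(\<lambda>k. f (Suc k) / f k) \<longlonglongrightarrow> L"
    and rec: "\<And>k. f (k + 4) + c3 * f (k + 3) + c2 * f (k + 2) + c1 * f (k + 1) + c0 * f k = 0"
  shows "L ^ 4 + c3 * L ^ 3 + c2 * L\<^sup>2 + c1 * L + c0 = 0"
proof -
  have nzj: "eventually (\<lambda>k. f (k + j) \<noteq> 0) sequentially" for j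
    by (rule eventually_sequentially_seg[of "\<lambda>k. f k \<noteq> 0" j, THEN iffD2, OF nz])
  have pow: "(\<lambda>k. f (k + j) / f k) \<longlonglongrightarrow> L ^ j" for j
  proof (induction j)
    case 0
    have "eventually (\<lambda>k. 1 = f (k + 0) / f k) sequentially" using nz by eventually_elim simp
    then show ?case by (simp add: Lim_transform_eventually[OF tendsto_const])
  next
    case (Suc j)
    have "(\<lambda>k. (f (Suc (k + j)) / f (k + j)) * (f (k + j) / f k)) \<longlonglongrightarrow> L * L ^ j"
      by (intro tendsto_mult Suc LIMSEQ_ignore_initial_segment[OF lim])
    moreover have "eventually (\<lambda>k. (f (Suc (k + j)) / f (k + j)) * (f (k + j) / f k) = f (k + Suc j) / f k) sequentially"
      using nzj[of j] by eventually_elim simp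
    ultimately show ?case by (simp add: Lim_transform_eventually)
  qed
  have "(\<lambda>k. f (k + 4) / f k + c3 * (f (k + 3) / f k) + c2 * (f (k + 2) / f k) + c1 * (f (k + 1) / f k) + c0)
      \<longlonglongrightarrow> L ^ 4 + c3 * L ^ 3 + c2 * L ^ 2 + c1 * L ^ 1 + c0"
    by (intro tendsto_intros pow)
  moreover have "eventually (\<lambda>k. f (k + 4) / f k + c3 * (f (k + 3) / f k) + c2 * (f (k + 2) / f k)
      + c1 * (f (k + 1) / f k) + c0 = 0) sequentially"
    using nz
  proof eventually_elim
    case (elim k)
    have "f (k + 4) / f k + c3 * (f (k + 3) / f k) + c2 * (f (k + 2) / f k) + c1 * (f (k + 1) / f k) + c0
        = (f (k + 4) + c3 * f (k + 3) + c2 * f (k + 2) + c1 * f (k + 1) + c0 * f k) / f k"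
      using elim by (simp add: add_divide_distrib)
    also have "\<dots> = 0" unfolding rec by simp
    finally show ?case .
  qed
  ultimately have "(\<lambda>k. 0) \<longlonglongrightarrow> L ^ 4 + c3 * L ^ 3 + c2 * L ^ 2 + c1 * L ^ 1 + c0"
    by (rule Lim_transform_eventually)
  then show ?thesis by (simp add: LIMSEQ_const_iff)
qed

text \<open>For c = cos b the roots are exp (i b) and exp (-i b); only 1 and -1 are both real and on
  the unit circle.\<close>

lemma real_unit_root:
  fixes L c :: real
  assumes "\<bar>c\<bar> \<le> 1" "L\<^sup>2 - 2 * c * L + 1 = 0"
  shows "c = L" "\<bar>L\<bar> = 1"
proof -
  have "(L - c)\<^sup>2 = c\<^sup>2 - 1" using assms(2) by (simp add: power2_eq_square algebra_simps)
  moreover have "c\<^sup>2 \<le> 1" using assms(1) by (simp add: abs_square_le_1)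
  ultimately have "(L - c)\<^sup>2 = 0" "c\<^sup>2 = 1" using zero_le_power2[of "L - c"] by linarith+
  then show "c = L" "\<bar>L\<bar> = 1" by (auto simp: power2_eq_1_iff)
qed

text \<open>The addition theorem makes cos (a + b k) sin b a null sequence as well. The squares of
  this and of sin (a + b k) sin b add up to the constant (sin b)^2.\<close>

lemma sin_tendsto_0_imp_sin_step_0:
  fixes a b :: real
  assumes "(\<lambda>k. sin (a + b * real k)) \<longlonglongrightarrow> 0"
  shows "sin b = 0"
proof -
  let ?s = "\<lambda>k. sin (a + b * real k)" and ?c = "\<lambda>k. cos (a + b * real k)"
  have "?s (Suc k) - ?s k * cos b = ?c k * sin b" for k
  proof -
    have "sin (a + b * real k + b) = ?s k * cos b + ?c k * sin b" by (rule sin_add)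
    then show ?thesis by (simp add: algebra_simps)
  qed
  moreover have "(\<lambda>k. ?s (Suc k) - ?s k * cos b) \<longlonglongrightarrow> 0 - 0 * cos b"
    by (intro tendsto_intros assms LIMSEQ_Suc)
  ultimately have cs: "(\<lambda>k. ?c k * sin b) \<longlonglongrightarrow> 0" by simp
  have "(\<lambda>k. (?c k * sin b)\<^sup>2 + (?s k * sin b)\<^sup>2) \<longlonglongrightarrow> 0\<^sup>2 + (0 * sin b)\<^sup>2"
    by (intro tendsto_intros cs assms)
  moreover have "(?c k * sin b)\<^sup>2 + (?s k * sin b)\<^sup>2 = (sin b)\<^sup>2" for k
    by (simp add: power_mult_distrib flip: distrib_right)
  ultimately show ?thesis by (simp add: LIMSEQ_const_iff)
qed

lemma cos_add_mult_of_sin_0: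
  fixes a b :: real
  assumes "sin b = 0"
  shows "cos (a + b * real k) = cos b ^ k * cos a"
proof (induction k)
  case (Suc k)
  have "cos (a + b * real (Suc k)) = cos (a + b * real k + b)" by (simp add: algebra_simps)
  also have "\<dots> = cos (a + b * real k) * cos b" unfolding cos_add by (simp add: assms)
  finally show ?case using Suc by simp
qed simp

lemma cos_sq_1_of_sin_0: "sin (b::real) = 0 \<Longrightarrow> cos b = 1 \<or> cos b = - 1"
  using sin_cos_squared_add[of b] by (simp add: power2_eq_1_iff)

text \<open>Because cos b = L is a sign, the first cosine is L^k cos a. Multiplying f k by L^k makes
  this part constant and turns the ratio limit into 1; the bounded sequence so obtained has
  differences tending to 0, which constrains the other frequency.\<close>

lemma cos_difference_ratio_limit:
  fixes a b a' b' L :: real and f :: "nat \<Rightarrow> real"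
  assumes f: "\<And>k. f k = cos (a + b * real k) - cos (a' + b' * real k)"
    and nz: "eventually (\<lambda>k. f k \<noteq> 0) sequentially"
    and lim: "(\<lambda>k. f (Suc k) / f k) \<longlonglongrightarrow> L"
    and L: "cos b = L" "\<bar>L\<bar> = 1"
  shows "sin b' = 0 \<and> (cos b' = L \<or> cos b' = - L \<and> cos a' = 0)"
proof -
  have LL: "L * L = 1" using L(2) by (metis abs_mult_self mult_1)
  have sb: "sin b = 0" using sin_cos_squared_add[of b] LL L(1) by (simp add: power2_eq_square)
  \<comment> \<open>Chosen so that L^k = cos (\<theta> k): the sign is absorbed into the frequency c
    of the second cosine.\<close>
  define \<theta> where "\<theta> = (if L = 1 then 0 else pi)"
  have \<theta>: "sin \<theta> = 0" "cos \<theta> = L" using L(2) by (auto simp: \<theta>_def abs_if split: if_splits)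
  define c where "c = b' + \<theta>"
  define g where "g k = cos a - cos (a' + c * real k)" for k
  have g: "g k = L ^ k * f k" for k
  proof -
    have "cos (a' + c * real k) = cos (a' + b' * real k + \<theta> * real k)"
      by (simp add: c_def algebra_simps)
    also have "\<dots> = L ^ k * cos (a' + b' * real k)"
      using cos_add_mult_of_sin_0[OF \<theta>(1), of "a' + b' * real k" k] by (simp only: \<theta>(2))
    finally have 1: "cos (a' + c * real k) = L ^ k * cos (a' + b' * real k)" .
    have "L ^ k * (L ^ k * cos a) = cos a"
      using LL by (simp add: mult.assoc[symmetric] flip: power_mult_distrib)
    then show ?thesis
      unfolding g_def f 1 cos_add_mult_of_sin_0[OF sb] L(1) by (simp add: right_diff_distrib)
  qed
  \<comment> \<open>A null sequence times a bounded one; the product equals g (k + 1) - g k whenever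
    f k is nonzero.\<close>
  have "(\<lambda>k. (L * (f (Suc k) / f k) - 1) * g k) \<longlonglongrightarrow> 0"
  proof (rule Lim_null_comparison)
    show "\<forall>\<^sub>F k in sequentially. norm ((L * (f (Suc k) / f k) - 1) * g k)
        \<le> \<bar>L * (f (Suc k) / f k) - 1\<bar> * 2"
    proof (intro always_eventually allI)
      fix k
      have "\<bar>g k\<bar> \<le> \<bar>cos a\<bar> + \<bar>cos (a' + c * real k)\<bar>"
        unfolding g_def by (rule abs_triangle_ineq4)
      also have "\<dots> \<le> 2" using abs_cos_le_one[of a] abs_cos_le_one[of "a' + c * real k"] by linarith
      finally show "norm ((L * (f (Suc k) / f k) - 1) * g k) \<le> \<bar>L * (f (Suc k) / f k) - 1\<bar> * 2"
        by (simp add: abs_mult mult_left_mono)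
    qed
    have "(\<lambda>k. \<bar>L * (f (Suc k) / f k) - 1\<bar> * 2) \<longlonglongrightarrow> \<bar>L * L - 1\<bar> * 2"
      by (intro tendsto_intros lim)
    then show "(\<lambda>k. \<bar>L * (f (Suc k) / f k) - 1\<bar> * 2) \<longlonglongrightarrow> 0" by (simp add: LL)
  qed
  moreover have "eventually (\<lambda>k. (L * (f (Suc k) / f k) - 1) * g k
      = cos (a' + c * real k) - cos (a' + c * real (Suc k))) sequentially"
    using nz
  proof eventually_elim
    case (elim k)
    have "(L * (f (Suc k) / f k) - 1) * g k = g (Suc k) - g k"
      unfolding g using elim by (simp add: left_diff_distrib)
    then show ?case by (simp add: g_def)
  qed
  ultimately have diff: "(\<lambda>k. cos (a' + c * real k) - cos (a' + c * real (Suc k))) \<longlonglongrightarrow> 0"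
    by (rule Lim_transform_eventually)
  have sc: "sin c = 0"
  proof (cases "sin (c / 2) = 0")
    case True
    then show ?thesis using sin_double[of "c / 2"] by simp
  next
    case False
    have "cos (a' + c * real k) - cos (a' + c * real (Suc k))
        = 2 * sin (c / 2) * sin (a' + c / 2 + c * real k)" for k
    proof -
      have "cos (y - c / 2) - cos (y + c / 2) = 2 * sin (c / 2) * sin y" for y
        unfolding cos_add cos_diff by simp
      from this[of "a' + c / 2 + c * real k"] show ?thesis by (simp add: algebra_simps)
    qed
    with diff have "(\<lambda>k. 2 * sin (c / 2) * sin (a' + c / 2 + c * real k)) \<longlonglongrightarrow> 0" by simp
    from tendsto_mult[OF tendsto_const[of "inverse (2 * sin (c / 2))"] this]
    have "(\<lambda>k. sin (a' + c / 2 + c * real k)) \<longlonglongrightarrow> 0"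
      using False by (simp add: mult.assoc[symmetric])
    then show ?thesis by (rule sin_tendsto_0_imp_sin_step_0)
  qed
  \<comment> \<open>The remaining possibility is cos c = -1; then the differences have absolute
    value 2 |cos a'| for every k, which forces cos a' = 0.\<close>
  have "cos c = 1 \<or> cos a' = 0"
  proof (rule disjCI)
    assume a': "cos a' \<noteq> 0"
    have "(\<lambda>k. norm (cos c ^ k * cos a' - cos c ^ Suc k * cos a')) \<longlonglongrightarrow> norm (0::real)"
      using diff unfolding cos_add_mult_of_sin_0[OF sc] by (rule tendsto_norm)
    moreover have "norm (cos c ^ k * cos a' - cos c ^ Suc k * cos a') = \<bar>1 - cos c\<bar> * \<bar>cos a'\<bar>" for k
    proof -
      have "cos c ^ k * cos a' - cos c ^ Suc k * cos a' = cos c ^ k * ((1 - cos c) * cos a')"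
        by (simp add: algebra_simps)
      moreover have "\<bar>cos c ^ k\<bar> = 1" using cos_sq_1_of_sin_0[OF sc] by (auto simp: power_abs)
      ultimately show ?thesis by (simp add: abs_mult)
    qed
    ultimately have "\<bar>1 - cos c\<bar> * \<bar>cos a'\<bar> = 0" by (simp add: LIMSEQ_const_iff)
    then show "cos c = 1" using a' by simp
  qed
  moreover have "b' = c - \<theta>" by (simp add: c_def)
  then have "sin b' = 0" "cos b' = cos c * L"
    by (simp_all add: sin_diff cos_diff \<theta> sc)
  ultimately show ?thesis using cos_sq_1_of_sin_0[OF sc] by auto
qed

lemma half_int_of_cos_pi_0: "cos (pi * y) = 0 \<Longrightarrow> y - 1 / 2 \<in> \<int>"
proof -
  assume "cos (pi * y) = 0"
  then obtain n :: int where "pi * y = n * pi + pi / 2" by (auto simp: cos_zero_iff_int2)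
  then have "pi * y = pi * (of_int n + 1 / 2)" by (simp add: algebra_simps)
  then have "y - 1 / 2 = of_int n" by simp
  then show ?thesis by simp
qed

lemma int_of_cos_2pi: "cos (2 * pi * y) = 1 \<Longrightarrow> y \<in> \<int>"
  by (auto simp: cos_one_2pi_int)

text \<open>Twice the product of sines is a difference of cosines with frequencies pi (p - q) and pi
  (p + q). L must be the cosine of one of them, and \<open>cos_difference_ratio_limit\<close> fixes
  the other up to sign. Equal cosines make p and q integers; opposite ones make them half-integers
  and impose a condition on the phases.\<close>

lemma sin_product_ratio_limit:
  fixes \<alpha> \<beta> p q L :: real and s :: "nat \<Rightarrow> real"
  assumes s: "\<And>k. s k = sin (pi * (\<alpha> + p * real k)) * sin (pi * (\<beta> + q * real k))"
    and nz: "eventually (\<lambda>k. s k \<noteq> 0) sequentially"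
    and lim: "(\<lambda>k. s (Suc k) / s k) \<longlonglongrightarrow> L"
  shows "\<bar>L\<bar> = 1"
    and "(p \<in> \<int> \<and> q \<in> \<int> \<and> cos (pi * (p + q)) = L) \<or>
         (p - 1 / 2 \<in> \<int> \<and> q - 1 / 2 \<in> \<int> \<and>
           (cos (pi * (p + q)) = L \<and> \<alpha> - \<beta> - 1 / 2 \<in> \<int> \<or>
            cos (pi * (p + q)) = - L \<and> \<alpha> + \<beta> - 1 / 2 \<in> \<int>))"
proof -
  define a b a' b' where "a = pi * (\<alpha> - \<beta>)" and "b = pi * (p - q)"
    and "a' = pi * (\<alpha> + \<beta>)" and "b' = pi * (p + q)"
  define f where "f k = cos (a + b * real k) - cos (a' + b' * real k)" for k
  have f: "f k = 2 * s k" for k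
  proof -
    let ?x = "pi * (\<alpha> + p * real k)" and ?y = "pi * (\<beta> + q * real k)"
    have "cos (?x - ?y) - cos (?x + ?y) = 2 * (sin ?x * sin ?y)"
      unfolding cos_add cos_diff by simp
    moreover have "?x - ?y = a + b * real k" "?x + ?y = a' + b' * real k"
      by (simp_all add: a_def b_def a'_def b'_def algebra_simps)
    ultimately show ?thesis by (simp only: f_def s)
  qed
  have f_nz: "eventually (\<lambda>k. f k \<noteq> 0) sequentially" using nz by eventually_elim (simp add: f)
  have f_lim: "(\<lambda>k. f (Suc k) / f k) \<longlonglongrightarrow> L" using lim by (simp add: f)
  let ?c = "cos b" and ?c' = "cos b'"
  have "f (k + 4) + (- 2 * (?c + ?c')) * f (k + 3) + (2 + 4 * (?c * ?c')) * f (k + 2)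
           + (- 2 * (?c + ?c')) * f (k + 1) + 1 * f k = 0" for k
    using cos_difference_recurrence[OF f_def, of k] by (simp only: mult_1)
  from ratio_limit_is_root[OF f_nz f_lim this]
  have "(L\<^sup>2 - 2 * ?c * L + 1) * (L\<^sup>2 - 2 * ?c' * L + 1) = 0"
    by (simp add: algebra_simps power2_eq_square power3_eq_cube power4_eq_xxxx)
  then have roots: "?c = L \<and> \<bar>L\<bar> = 1 \<or> ?c' = L \<and> \<bar>L\<bar> = 1"
    using real_unit_root abs_cos_le_one unfolding mult_eq_0_iff by metis
  then show "\<bar>L\<bar> = 1" by blast
  have LL: "L * L = 1" using \<open>\<bar>L\<bar> = 1\<close> by (metis abs_mult_self mult_1)
  have sin_0: "sin y = 0" if "cos y = L" for y
    using sin_cos_squared_add[of y] LL that by (simp add: power2_eq_square)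
  have cases: "sin b = 0 \<and> sin b' = 0 \<and>
      (?c = L \<and> ?c' = L \<or> ?c = L \<and> ?c' = - L \<and> cos a' = 0 \<or> ?c = - L \<and> ?c' = L \<and> cos a = 0)"
    using roots
  proof (elim disjE conjE)
    assume c: "?c = L" "\<bar>L\<bar> = 1"
    from cos_difference_ratio_limit[of f a b a' b' L, OF f_def f_nz f_lim c] sin_0[OF c(1)] c
    show ?thesis by blast
  next
    assume c: "?c' = L" "\<bar>L\<bar> = 1"
    \<comment> \<open>Changing the sign of f exchanges the roles of the two cosines and keeps the
      ratios.\<close>
    have "eventually (\<lambda>k. - f k \<noteq> 0) sequentially" "(\<lambda>k. - f (Suc k) / - f k) \<longlonglongrightarrow> L"
      using f_nz f_lim by simp_all
    from cos_difference_ratio_limit[of "\<lambda>k. - f k" a' b' a b L, OF _ this c] sin_0[OF c(1)] c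
    show ?thesis by (auto simp: f_def)
  qed
  have ints: "p - q \<in> \<int>" "p + q \<in> \<int>"
    using cases sin_times_pi_eq_0[of "p - q"] sin_times_pi_eq_0[of "p + q"]
    by (simp_all add: b_def b'_def mult.commute)
  \<comment> \<open>Both factors are signs, and their product decides between integral and
    half-integral p.\<close>
  have cos_2p: "cos (2 * pi * p) = ?c * ?c'"
  proof -
    have "cos (2 * pi * p) = cos (b + b')" by (simp add: b_def b'_def algebra_simps)
    then show ?thesis using cases by (simp add: cos_add)
  qed
  have whole: "p \<in> \<int> \<and> q \<in> \<int>" if "?c = L" "?c' = L"
  proof -
    have p: "p \<in> \<int>" using cos_2p that LL by (intro int_of_cos_2pi) simp
    then have "p - (p - q) \<in> \<int>" using ints(1) by (rule Ints_diff)
    with p show ?thesis by simp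
  qed
  have half: "p - 1 / 2 \<in> \<int> \<and> q - 1 / 2 \<in> \<int>" if "?c * ?c' = - 1"
  proof -
    have "cos (2 * pi * (p - 1 / 2)) = cos (2 * pi * p - pi)" by (simp add: algebra_simps)
    then have "cos (2 * pi * (p - 1 / 2)) = 1" using cos_2p that by simp
    then have p: "p - 1 / 2 \<in> \<int>" by (rule int_of_cos_2pi)
    have "(p + q) - (p - 1 / 2) - 1 \<in> \<int>" by (rule Ints_diff[OF Ints_diff[OF ints(2) p] Ints_1])
    moreover have "(p + q) - (p - 1 / 2) - 1 = q - 1 / 2" by simp
    ultimately show ?thesis using p by (simp only:)
  qed
  show "(p \<in> \<int> \<and> q \<in> \<int> \<and> cos (pi * (p + q)) = L) \<or>
         (p - 1 / 2 \<in> \<int> \<and> q - 1 / 2 \<in> \<int> \<and>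
           (cos (pi * (p + q)) = L \<and> \<alpha> - \<beta> - 1 / 2 \<in> \<int> \<or>
            cos (pi * (p + q)) = - L \<and> \<alpha> + \<beta> - 1 / 2 \<in> \<int>))"
    using cases
  proof (elim disjE conjE)
    assume "?c = L" "?c' = L"
    then show ?thesis using whole by (simp add: b'_def)
  next
    assume c: "?c = L" "?c' = - L" "cos a' = 0"
    then show ?thesis using half half_int_of_cos_pi_0[of "\<alpha> + \<beta>"] LL by (simp add: a'_def b'_def)
  next
    assume c: "?c = - L" "?c' = L" "cos a = 0"
    then show ?thesis using half half_int_of_cos_pi_0[of "\<alpha> - \<beta>"] LL by (simp add: a_def b'_def)
  qed
qed

subsection \<open>Identities between entire functions\<close>

lemma entire_nonzero_cosparse:
  assumes "h holomorphic_on UNIV" "h w0 \<noteq> 0"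
  shows "eventually (\<lambda>w. h w \<noteq> 0) (cosparse UNIV)"
proof -
  have "eventually (\<lambda>w. h w \<noteq> 0 \<and> w \<in> UNIV) (at z)" for z
    by (rule non_zero_neighbour_alt[OF assms(1)]) (use assms in auto)
  then show ?thesis by (simp add: eventually_cosparse_open_eq)
qed

lemma poly_nonzero_cosparse:
  fixes P :: "complex poly"
  assumes "P \<noteq> 0"
  shows "eventually (\<lambda>w. poly P w \<noteq> 0) (cosparse UNIV)"
proof -
  obtain w0 where "poly P w0 \<noteq> 0" using assms poly_all_0_iff_0 by blast
  then show ?thesis by (intro entire_nonzero_cosparse[of "poly P"] holomorphic_intros)
qed

lemma eventually_cosparse_shift:
  fixes c :: complex
  assumes "eventually P (cosparse UNIV)"
  shows "eventually (\<lambda>w. P (w + c)) (cosparse UNIV)"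
proof -
  have "eventually (\<lambda>w. P (w + c)) (at z)" for z
  proof -
    have "eventually P (at (z + c))"
      using assms by (simp add: eventually_cosparse_open_eq)
    then show ?thesis
      by (simp only: at_to_0[of "z + c"] at_to_0[of z] eventually_filtermap add.assoc)
  qed
  then show ?thesis by (simp add: eventually_cosparse_open_eq)
qed

lemma entire_eq_of_cosparse:
  assumes "F holomorphic_on UNIV" "G holomorphic_on UNIV"
    and "eventually (\<lambda>w. F w = G w) (cosparse UNIV)"
  shows "F w = G w"
proof -
  have "isCont F w" "isCont G w"
    using assms(1,2) holomorphic_on_imp_continuous_on continuous_on_eq_continuous_at by blast+
  then have lims: "F \<midarrow>w\<rightarrow> F w" "G \<midarrow>w\<rightarrow> G w" by (auto simp: isCont_def)
  have "eventually (\<lambda>w. F w = G w) (at w)"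
    using assms(3) by (simp add: eventually_cosparse_open_eq)
  then have "G \<midarrow>w\<rightarrow> F w" using lims(1) by (rule Lim_transform_eventually[rotated])
  then show ?thesis using lims(2) by (rule LIM_unique)
qed

text \<open>Entire functions form an integral domain.\<close>

lemma entire_cancel:
  assumes "K holomorphic_on UNIV" "F holomorphic_on UNIV" "G holomorphic_on UNIV"
    and "K w0 \<noteq> 0" and "\<And>w. K w * F w = K w * G w"
  shows "F w = G w"
proof (rule entire_eq_of_cosparse[OF assms(2,3)])
  show "eventually (\<lambda>w. F w = G w) (cosparse UNIV)"
    using entire_nonzero_cosparse[OF assms(1,4)]
    by eventually_elim (use assms(5) in \<open>metis mult_left_cancel\<close>)
qed

lemma holomorphic_shift: "h holomorphic_on UNIV \<Longrightarrow> (\<lambda>w. h (w + c)) holomorphic_on UNIV"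
  using holomorphic_on_compose[of "\<lambda>w. w + c" UNIV h]
  by (simp add: o_def holomorphic_intros holomorphic_on_subset)

text \<open>The cross-multiplied form of f(w + 1) / f(w) = S(w + 1) / S(w) * U / V with f = G / E
  and S = P / Q. For the induction step, the identity for N is multiplied by the basic one at w + N;
  both sides then share the factor \<open>?K\<close>, which is not identically zero and can be
  cancelled.\<close>

lemma shift_identity_iterate:
  assumes hol: "E holomorphic_on UNIV" "G holomorphic_on UNIV" "P holomorphic_on UNIV"
      "Q holomorphic_on UNIV" "U holomorphic_on UNIV" "V holomorphic_on UNIV"
    and nz: "E w0 * G w0 * P w0 * Q w0 \<noteq> 0"
    and id: "\<And>w. E w * G (w + 1) * P w * Q (w + 1) * V w = E (w + 1) * G w * P (w + 1) * Q w * U w"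
  shows "E w * G (w + of_nat N) * P w * Q (w + of_nat N) * (\<Prod>l<N. V (w + of_nat l)) =
         E (w + of_nat N) * G w * P (w + of_nat N) * Q w * (\<Prod>l<N. U (w + of_nat l))"
proof (induction N arbitrary: w)
  case (Suc N)
  let ?z = "\<lambda>w. w + complex_of_nat N"
  let ?K = "\<lambda>w. E (?z w) * G (?z w) * P (?z w) * Q (?z w)"
  let ?L = "\<lambda>w. E w * G (?z w + 1) * P w * Q (?z w + 1) * ((\<Prod>l<N. V (w + of_nat l)) * V (?z w))"
  let ?R = "\<lambda>w. E (?z w + 1) * G w * P (?z w + 1) * Q w * ((\<Prod>l<N. U (w + of_nat l)) * U (?z w))"
  have "?L w = ?R w"
  proof (rule entire_cancel[of ?K ?L ?R "w0 - of_nat N" w])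
    fix w
    have "?K w * ?L w =
        (E w * G (?z w) * P w * Q (?z w) * (\<Prod>l<N. V (w + of_nat l))) *
        (E (?z w) * G (?z w + 1) * P (?z w) * Q (?z w + 1) * V (?z w))"
      by (simp only: mult_ac)
    also have "\<dots> = ?K w * ?R w"
      unfolding Suc id by (simp only: mult_ac)
    finally show "?K w * ?L w = ?K w * ?R w" .
  next
    show "?K (w0 - of_nat N) \<noteq> 0" using nz by simp
  qed (use hol in \<open>auto simp: add.assoc intro!: holomorphic_intros holomorphic_shift\<close>)
  then show ?case by (simp add: add_ac)
qed simp

section \<open>Polynomials near infinity\<close>

lemma poly_ratio_tendsto_1:
  fixes P Q :: "complex poly"
  assumes "degree P = degree Q" "lead_coeff P = lead_coeff Q" "P \<noteq> 0"
  shows "((\<lambda>w. poly P w / poly Q w) \<longlongrightarrow> 1) at_infinity"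
proof -
  have "lead_coeff P \<noteq> 0" using assms(3) by simp
  then have Q: "Q \<noteq> 0" unfolding assms(2) by auto
  have "((\<lambda>w. (poly P w / w ^ degree P) / (poly Q w / w ^ degree Q)) \<longlongrightarrow>
      lead_coeff P / lead_coeff Q) at_infinity"
    by (intro tendsto_divide poly_divide_tendsto_aux) (use Q in auto)
  moreover have "eventually (\<lambda>w::complex. w \<noteq> 0) at_infinity"
    unfolding eventually_at_infinity by (rule exI[of _ 1]) auto
  then have "eventually (\<lambda>w. (poly P w / w ^ degree P) / (poly Q w / w ^ degree Q)
      = poly P w / poly Q w) at_infinity"
    by eventually_elim (use assms in simp)
  ultimately have "((\<lambda>w. poly P w / poly Q w) \<longlongrightarrow> lead_coeff P / lead_coeff Q) at_infinity"
    by (rule Lim_transform_eventually)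
  moreover have "lead_coeff P / lead_coeff Q = 1" using assms Q by simp
  ultimately show ?thesis by (simp only:)
qed

lemma poly_nonzero_at_infinity:
  fixes P :: "complex poly"
  assumes "P \<noteq> 0"
  shows "eventually (\<lambda>w. poly P w \<noteq> 0) at_infinity"
proof -
  have "finite {w. poly P w = 0}" using assms by (rule poly_roots_finite)
  then have "bounded {w. poly P w = 0}" by (rule finite_imp_bounded)
  then obtain b where "\<And>w. poly P w = 0 \<Longrightarrow> norm w \<le> b" by (auto simp: bounded_iff)
  then show ?thesis
    unfolding eventually_at_infinity by (intro exI[of _ "b + 1"]) force
qed

lemma filterlim_add_of_nat_at_infinity:
  fixes c :: complex
  shows "filterlim (\<lambda>n. c + of_nat n) at_infinity sequentially"
    and "filterlim (\<lambda>n. c - of_nat n) at_infinity sequentially"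
proof -
  have nat: "filterlim (\<lambda>n. of_nat n :: complex) at_infinity sequentially"
    by (rule tendsto_of_nat)
  then show "filterlim (\<lambda>n. c + of_nat n) at_infinity sequentially"
    by (rule tendsto_add_filterlim_at_infinity[OF tendsto_const])
  have "filterlim (\<lambda>n. - complex_of_nat n) at_infinity sequentially"
    by (rule filterlim_norm_at_top_imp_at_infinity) (simp add: filterlim_real_sequentially)
  then have "filterlim (\<lambda>n. c + - of_nat n) at_infinity sequentially"
    by (rule tendsto_add_filterlim_at_infinity[OF tendsto_const])
  then show "filterlim (\<lambda>n. c - of_nat n) at_infinity sequentially" by simp
qed

lemma eventually_poly_nonzero:
  fixes R :: "complex poly"
  assumes "R \<noteq> 0"
  shows "eventually (\<lambda>n. poly R (c + of_nat n) \<noteq> 0) sequentially"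
    and "eventually (\<lambda>n. poly R (c - of_nat n) \<noteq> 0) sequentially"
  using filterlim_add_of_nat_at_infinity[of c] poly_nonzero_at_infinity[OF assms]
  unfolding filterlim_iff by blast+

subsection \<open>Poles of the hypergeometric function\<close>

locale gauss_parameters =
  fixes p q r a b x :: real
  assumes p: "0 < p" "p < r" and q: "0 < q" "q < r" and x: "-1 < x" "x < 1" "x \<noteq> 0"
begin

definition denom :: "complex \<Rightarrow> complex" where
  "denom w = rGamma (of_real r * w)"

definition numer :: "complex \<Rightarrow> complex" where
  "numer w = reg_2F1 (of_real p * w + of_real a) (of_real q * w + of_real b) (of_real r * w) (of_real x)"

abbreviation f :: "complex \<Rightarrow> complex" where
  "f \<equiv> hyp_f (of_real p) (of_real q) (of_real r) (of_real a) (of_real b) (of_real x)"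

lemma r_pos: "0 < r" and abs_x: "\<bar>x\<bar> < 1" and norm_x: "norm (complex_of_real x) < 1"
  using p x by auto

lemma holomorphic_numer: "numer holomorphic_on UNIV"
  unfolding numer_def[abs_def] by (intro holomorphic_reg_2F1 norm_x holomorphic_intros)

lemma holomorphic_denom: "denom holomorphic_on UNIV"
  unfolding denom_def[abs_def] by (intro holomorphic_intros)

lemma f_eq: "denom w \<noteq> 0 \<Longrightarrow> f w = numer w / denom w"
  using gauss_2F1_times_rGamma[OF norm_x, of "of_real r * w" "of_real p * w + of_real a" "of_real q * w + of_real b"]
  by (simp add: hyp_f_def numer_def denom_def field_simps)

lemma denom_eq_0_iff: "denom w = 0 \<longleftrightarrow> of_real r * w \<in> \<int>\<^sub>\<le>\<^sub>0"
  by (simp add: denom_def rGamma_eq_zero_iff)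

lemma denom_nonzero: "0 < Re w \<Longrightarrow> denom w \<noteq> 0"
proof
  assume w: "0 < Re w" and "denom w = 0"
  then obtain n where "of_real r * w = - of_nat n"
    by (auto simp: denom_eq_0_iff elim!: nonpos_Ints_cases')
  then have "r * Re w = - real n" by (auto dest: arg_cong[of _ _ Re])
  moreover have "0 < r * Re w" using w r_pos by simp
  ultimately show False by simp
qed

lemma eventually_denom_nonzero: "eventually (\<lambda>n. denom (c + of_nat n) \<noteq> 0) sequentially"
proof -
  have "eventually (\<lambda>n. real n > - Re c) sequentially"
    using filterlim_real_sequentially by (simp add: filterlim_at_top_dense)
  then show ?thesis by eventually_elim (auto intro!: denom_nonzero)
qed

lemma f_shift:
  "f (c + of_nat n) = gauss_2F1 ((of_real p * c + of_real a) + of_real p * of_nat n)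
     ((of_real q * c + of_real b) + of_real q * of_nat n) (of_real r * c + of_real r * of_nat n) (of_real x)"
  by (simp add: hyp_f_def algebra_simps)

lemma eventually_numer_nonzero: "eventually (\<lambda>n. numer (c + of_nat n) \<noteq> 0) sequentially"
  using gauss_2F1_asymptotics(1)[OF abs_x q, of "of_real p * c + of_real a" p "of_real q * c + of_real b" "of_real r * c"]
    eventually_denom_nonzero[of c]
proof eventually_elim
  case (elim n)
  then show ?case using f_eq[OF elim(2)] by (auto simp: f_shift)
qed

lemma f_ratio_tendsto:
  "(\<lambda>n. f (c + of_nat (Suc n)) / f (c + of_nat n)) \<longlonglongrightarrow>
     of_real (euler_peak p q (r - q) x / euler_peak 0 q (r - q) x)"
  unfolding f_shift by (rule gauss_2F1_asymptotics(2)[OF abs_x q])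

lemma denom_simple_zero:
  assumes "denom z = 0"
  obtains D where "D \<noteq> 0" "(denom has_field_derivative D) (at z)"
proof -
  obtain n where n: "of_real r * z = - of_nat n"
    using assms by (auto simp: denom_eq_0_iff elim!: nonpos_Ints_cases')
  have "(rGamma has_field_derivative (- 1) ^ n * fact n) (at (of_real r * z))"
    unfolding n by (rule has_field_derivative_rGamma_nonpos_int)
  moreover have "((\<lambda>w. of_real r * w) has_field_derivative of_real r) (at z)"
    by (auto intro!: derivative_eq_intros)
  ultimately have "(denom has_field_derivative (- 1) ^ n * fact n * of_real r) (at z)"
    unfolding denom_def[abs_def] by (rule DERIV_chain2)
  then show thesis by (rule that[rotated]) (use r_pos in simp)
qed

text \<open>The zeros of \<open>denom\<close> are simple, so a common zero with \<open>numer\<close>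
  would be a removable singularity: the quotient of the difference quotients converges.\<close>

lemma pole_imp:
  assumes pole: "is_pole f z"
  shows "denom z = 0" "numer z \<noteq> 0"
proof -
  have cont: "isCont numer z" "isCont denom z"
    using holomorphic_numer holomorphic_denom holomorphic_on_imp_continuous_on
      continuous_on_eq_continuous_at by blast+
  have "eventually (\<lambda>w. denom w \<noteq> 0) (at z)"
    using entire_nonzero_cosparse[OF holomorphic_denom denom_nonzero[of 1]]
    by (simp add: eventually_cosparse_open_eq)
  then have ev: "eventually (\<lambda>w. numer w / denom w = f w) (at z)"
    by eventually_elim (simp add: f_eq)
  have no_limit: False if "((\<lambda>w. numer w / denom w) \<longlongrightarrow> l) (at z)" for l
  proof -
    have "(f \<longlongrightarrow> l) (at z)" using that ev by (rule Lim_transform_eventually)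
    then show False using pole not_tendsto_and_filterlim_at_infinity[of "at z" f l]
      by (simp add: is_pole_def)
  qed
  show den: "denom z = 0"
  proof (rule ccontr)
    assume "denom z \<noteq> 0"
    then have "((\<lambda>w. numer w / denom w) \<longlongrightarrow> numer z / denom z) (at z)"
      using cont by (intro tendsto_divide) (auto simp: isCont_def)
    then show False by (rule no_limit)
  qed
  show "numer z \<noteq> 0"
  proof
    assume num: "numer z = 0"
    obtain D where D: "D \<noteq> 0" "(denom has_field_derivative D) (at z)"
      using denom_simple_zero[OF den] .
    obtain D' where "(numer has_field_derivative D') (at z)"
      using holomorphic_numer by (metis UNIV_I field_differentiable_def holomorphic_on_def)
    then have "((\<lambda>w. (numer w - numer z) / (w - z)) \<longlongrightarrow> D') (at z)"
      "((\<lambda>w. (denom w - denom z) / (w - z)) \<longlongrightarrow> D) (at z)"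
      using D(2) by (simp_all add: has_field_derivative_iff)
    then have "((\<lambda>w. ((numer w - numer z) / (w - z)) / ((denom w - denom z) / (w - z))) \<longlongrightarrow> D' / D) (at z)"
      using D(1) by (rule tendsto_divide)
    moreover have "eventually (\<lambda>w. ((numer w - numer z) / (w - z)) / ((denom w - denom z) / (w - z))
        = numer w / denom w) (at z)"
      using eventually_neq_at_within[of z z] by eventually_elim (simp add: num den)
    ultimately have "((\<lambda>w. numer w / denom w) \<longlongrightarrow> D' / D) (at z)"
      by (rule Lim_transform_eventually)
    then show False by (rule no_limit)
  qed
qed

lemma numer_denom_nonzero_point:
  assumes "P \<noteq> 0" "Q \<noteq> 0"
  obtains w0 where "denom w0 * numer w0 * poly P w0 * poly Q w0 \<noteq> 0"
proof -
  have "eventually (\<lambda>n. denom (0 + of_nat n) * numer (0 + of_nat n) *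
      poly P (0 + of_nat n) * poly Q (0 + of_nat n) \<noteq> 0) sequentially"
    using eventually_denom_nonzero[of 0] eventually_numer_nonzero[of 0]
      eventually_poly_nonzero(1)[OF assms(1), of 0] eventually_poly_nonzero(1)[OF assms(2), of 0]
    by eventually_elim simp
  from eventually_happens'[OF sequentially_bot this] show thesis using that by blast
qed

text \<open>P / Q represents S. After clearing denominators both sides are entire, so the equation,
  given only outside a sparse set, holds everywhere, in particular at the poles of f.\<close>

lemma canonical_form_identity:
  assumes "canonical_form (shift_ratio f) S d m u m v"
  obtains P Q where "P \<noteq> 0" "Q \<noteq> 0"
    "\<And>w. denom w * numer (w + 1) * poly P w * poly Q (w + 1) * (\<Prod>j=1..m. w + v j) =
         denom (w + 1) * numer w * poly P (w + 1) * poly Q w * (d * (\<Prod>i=1..m. w + u i))"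
proof -
  from assms obtain P Q where Q: "Q \<noteq> 0"
    and S: "eventually (\<lambda>w. S w = poly P w / poly Q w) (cosparse UNIV)"
    and S0: "\<not> eventually (\<lambda>w. S w = 0) (cosparse UNIV)"
    and R: "eventually (\<lambda>w. shift_ratio f w =
        S (w + 1) / S w * d * ((\<Prod>i=1..m. w + u i) / (\<Prod>j=1..m. w + v j))) (cosparse UNIV)"
    unfolding canonical_form_def rational_over_def by blast
  have P: "P \<noteq> 0"
  proof
    assume "P = 0"
    then have "eventually (\<lambda>w. S w = 0) (cosparse UNIV)" using S by simp
    with S0 show False by simp
  qed
  obtain w0 where w0: "denom w0 * numer w0 * poly P w0 * poly Q w0 \<noteq> 0"
    using numer_denom_nonzero_point[OF P Q] .
  let ?V = "\<lambda>w. \<Prod>j=1..m. w + v j" and ?U = "\<lambda>w. \<Prod>i=1..m. w + u i"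
  have "eventually (\<lambda>w. poly (\<Prod>j=1..m. [:v j, 1:]) w \<noteq> 0) (cosparse UNIV)"
    by (intro poly_nonzero_cosparse) simp
  then have V: "eventually (\<lambda>w. ?V w \<noteq> 0) (cosparse UNIV)"
    by (simp add: poly_prod add.commute)
  have den: "eventually (\<lambda>w. denom w \<noteq> 0) (cosparse UNIV)"
    and num: "eventually (\<lambda>w. numer w \<noteq> 0) (cosparse UNIV)"
    using w0 by (auto intro!: entire_nonzero_cosparse[of _ w0] holomorphic_denom holomorphic_numer)
  have ev: "eventually (\<lambda>w. denom w * numer (w + 1) * poly P w * poly Q (w + 1) * ?V w =
         denom (w + 1) * numer w * poly P (w + 1) * poly Q w * (d * ?U w)) (cosparse UNIV)"
    using R S eventually_cosparse_shift[OF S, of 1] V den eventually_cosparse_shift[OF den, of 1] num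
      poly_nonzero_cosparse[OF P] poly_nonzero_cosparse[OF Q]
      eventually_cosparse_shift[OF poly_nonzero_cosparse[OF Q], of 1]
  proof eventually_elim
    case (elim w)
    have "(numer (w + 1) / denom (w + 1)) / (numer w / denom w)
      = (poly P (w + 1) / poly Q (w + 1)) / (poly P w / poly Q w) * d * (?U w / ?V w)"
      using elim(1) unfolding shift_ratio_def f_eq[OF elim(5)] f_eq[OF elim(6)] elim(2,3) .
    then show ?case using elim(4-) by (simp add: field_simps)
  qed
  have "denom w * numer (w + 1) * poly P w * poly Q (w + 1) * ?V w =
         denom (w + 1) * numer w * poly P (w + 1) * poly Q w * (d * ?U w)" for w
    by (rule entire_eq_of_cosparse[OF _ _ ev])
      (intro holomorphic_intros holomorphic_shift holomorphic_denom holomorphic_numer)+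
  then show thesis using that P Q by blast
qed

end

subsection \<open>The shift identity and the location of the poles\<close>

lemma pochhammer_minus_of_nat_add:
  "pochhammer (- of_nat (n + k) :: 'a::field_char_0) k = (- 1) ^ k * (fact (n + k) / fact n)"
proof -
  have "pochhammer (1::'a) (n + k) = pochhammer 1 n * pochhammer (1 + of_nat n) k"
    by (rule pochhammer_product')
  then have "pochhammer (1 + of_nat n :: 'a) k = fact (n + k) / fact n"
    by (simp add: pochhammer_fact[symmetric] field_simps)
  moreover have "of_nat (n + k) - of_nat k + 1 = (1 + of_nat n :: 'a)" by simp
  ultimately show ?thesis unfolding pochhammer_minus by (simp only:)
qed

locale gauss_gamma_product = gauss_parameters +
  fixes P Q :: "complex poly" and d :: complex and m :: nat and u v :: "nat \<Rightarrow> complex"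
  assumes P_nz: "P \<noteq> 0" and Q_nz: "Q \<noteq> 0" and d_nz: "d \<noteq> 0"
    and uv: "\<And>i j. i \<in> {1..m} \<Longrightarrow> j \<in> {1..m} \<Longrightarrow> u i - v j \<notin> \<int>"
    and shift_identity: "\<And>w. denom w * numer (w + 1) * poly P w * poly Q (w + 1) * (\<Prod>j=1..m. w + v j) =
         denom (w + 1) * numer w * poly P (w + 1) * poly Q w * (d * (\<Prod>i=1..m. w + u i))"
begin

definition U :: "complex \<Rightarrow> complex" where "U w = (\<Prod>i=1..m. w + u i)"
definition V :: "complex \<Rightarrow> complex" where "V w = (\<Prod>j=1..m. w + v j)"

lemma holomorphic_U: "U holomorphic_on UNIV" and holomorphic_V: "V holomorphic_on UNIV"
  unfolding U_def[abs_def] V_def[abs_def] by (intro holomorphic_intros)+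

lemma iterated_identity:
  "denom w * numer (w + of_nat N) * poly P w * poly Q (w + of_nat N) * (\<Prod>l<N. V (w + of_nat l)) =
   denom (w + of_nat N) * numer w * poly P (w + of_nat N) * poly Q w * (\<Prod>l<N. d * U (w + of_nat l))"
proof -
  obtain w0 where w0: "denom w0 * numer w0 * poly P w0 * poly Q w0 \<noteq> 0"
    using numer_denom_nonzero_point[OF P_nz Q_nz] .
  show ?thesis
  proof (rule shift_identity_iterate[of denom numer "poly P" "poly Q" "\<lambda>w. d * U w" V w0 w N])
    show "denom w * numer (w + 1) * poly P w * poly Q (w + 1) * V w =
        denom (w + 1) * numer w * poly P (w + 1) * poly Q w * (d * U w)" for w
      unfolding U_def V_def by (rule shift_identity)
  qed (use w0 in \<open>intro holomorphic_intros holomorphic_denom holomorphic_numer holomorphic_U holomorphic_V | assumption\<close>)+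
qed

lemma far_point:
  obtains N where "k < N" "denom (z + of_nat N) \<noteq> 0" "numer (z + of_nat N) \<noteq> 0"
    "poly P (z + of_nat N) \<noteq> 0" "poly Q (z + of_nat N) \<noteq> 0"
proof -
  have "eventually (\<lambda>N. k < N \<and> denom (z + of_nat N) \<noteq> 0 \<and> numer (z + of_nat N) \<noteq> 0 \<and>
    poly P (z + of_nat N) \<noteq> 0 \<and> poly Q (z + of_nat N) \<noteq> 0) sequentially"
    using eventually_gt_at_top[of k] eventually_denom_nonzero[of z] eventually_numer_nonzero[of z]
      eventually_poly_nonzero(1)[OF P_nz, of z] eventually_poly_nonzero(1)[OF Q_nz, of z]
    by eventually_elim simp
  from eventually_happens'[OF sequentially_bot this] show thesis using that by blast
qed

text \<open>The iterated identity, evaluated at \<open>z = - u i - k\<close> for a number \<open>N > k\<close> of steps that reaches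
  the zero-free right half of the plane, has a vanishing right-hand side; since the zeros of \<^term>\<open>denom\<close>
  are simple, comparing derivatives shows that the zero there is not compensated by \<^term>\<open>numer\<close>.\<close>

lemma pole_orbit:
  assumes i: "i \<in> {1..m}" and Pz: "poly P (- u i - of_nat k) \<noteq> 0"
  shows "denom (- u i - of_nat k) = 0" "numer (- u i - of_nat k) \<noteq> 0"
proof -
  define z where "z = - u i - of_nat k"
  obtain N where N: "k < N" "denom (z + of_nat N) \<noteq> 0" "numer (z + of_nat N) \<noteq> 0"
    "poly P (z + of_nat N) \<noteq> 0" "poly Q (z + of_nat N) \<noteq> 0"
    using far_point .
  define Y where "Y w = numer (w + of_nat N) * poly P w * poly Q (w + of_nat N) * (\<Prod>l<N. V (w + of_nat l))" for w
  define Z where "Z w = denom (w + of_nat N) * poly P (w + of_nat N) * poly Q w * (\<Prod>l<N. d * U (w + of_nat l))" for w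
  have id: "denom w * Y w = numer w * Z w" for w
    using iterated_identity[of w N] by (simp add: Y_def Z_def mult_ac)
  \<comment> \<open>Here the canonical form enters: as u i - v j is never an integer, no zero of V
    lies on the orbit of - u i.\<close>
  have "V (z + of_nat l) \<noteq> 0" for l
  proof
    assume "V (z + of_nat l) = 0"
    then obtain j where j: "j \<in> {1..m}" "z + of_nat l + v j = 0"
      by (auto simp: V_def)
    then have "u i - v j = of_nat l - of_nat k" by (simp add: z_def algebra_simps)
    then have "u i - v j \<in> \<int>" by simp
    with uv[OF i j(1)] show False by simp
  qed
  then have Yz: "Y z \<noteq> 0" using N Pz by (simp add: Y_def z_def)
  have "U (z + of_nat k) = 0" using i by (auto simp: U_def z_def)
  then have Zz: "Z z = 0" using N(1) by (auto simp: Z_def)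
  show den: "denom (- u i - of_nat k) = 0"
    using id[of z] Yz Zz by (simp add: z_def)
  show "numer (- u i - of_nat k) \<noteq> 0"
  proof
    assume "numer (- u i - of_nat k) = 0"
    then have num: "numer z = 0" by (simp add: z_def)
    obtain D where D: "D \<noteq> 0" "(denom has_field_derivative D) (at z)"
      using denom_simple_zero den unfolding z_def by blast
    have "Y holomorphic_on UNIV" "Z holomorphic_on UNIV"
      unfolding Y_def[abs_def] Z_def[abs_def]
      by (intro holomorphic_intros holomorphic_shift holomorphic_numer holomorphic_denom
            holomorphic_U holomorphic_V)+
    then obtain Y' Z' D' where "(Y has_field_derivative Y') (at z)" "(Z has_field_derivative Z') (at z)"
      "(numer has_field_derivative D') (at z)"
      using holomorphic_numer by (metis UNIV_I field_differentiable_def holomorphic_on_def)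
    then have "((\<lambda>w. denom w * Y w) has_field_derivative D * Y z + Y' * denom z) (at z)"
      "((\<lambda>w. numer w * Z w) has_field_derivative D' * Z z + Z' * numer z) (at z)"
      using D(2) by (auto intro: DERIV_mult)
    then have "D * Y z + Y' * denom z = D' * Z z + Z' * numer z"
      unfolding id by (rule DERIV_unique)
    then show False using D(1) Yz Zz num den by (simp add: z_def)
  qed
qed

text \<open>At a pole the left-hand side of the iterated identity vanishes; without factors w + u i
  the right-hand side can vanish only through Q. Hence a non-elementary solution has at least one u
  i.\<close>

lemma finite_poles:
  assumes "m = 0"
  shows "finite {z. is_pole f z}"
proof (rule finite_subset)
  show "finite {z. poly Q z = 0}" using Q_nz by (rule poly_roots_finite)
  show "{z. is_pole f z} \<subseteq> {z. poly Q z = 0}"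
  proof safe
    fix z assume "is_pole f z"
    note pole = pole_imp[OF this]
    obtain N where N: "denom (z + of_nat N) \<noteq> 0" "poly P (z + of_nat N) \<noteq> 0"
      using far_point[of 0 z] by blast
    have "denom (z + of_nat N) * numer z * poly P (z + of_nat N) * poly Q z * (\<Prod>l<N. d * U (z + of_nat l)) = 0"
      using iterated_identity[of z N] pole by simp
    moreover have "U w = 1" for w unfolding U_def by (simp add: assms)
    ultimately show "poly Q z = 0" using N pole d_nz by simp
  qed
qed

lemma shift_parameter_ints:
  assumes i: "i \<in> {1..m}"
  shows "r \<in> \<int>" and "of_real r * u i \<in> \<int>"
proof -
  have ev: "eventually (\<lambda>k. poly P (- u i - of_nat k) \<noteq> 0) sequentially"
    by (rule eventually_poly_nonzero(2)[OF P_nz])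
  then obtain k0 where k0: "\<And>k. k \<ge> k0 \<Longrightarrow> poly P (- u i - of_nat k) \<noteq> 0"
    unfolding eventually_sequentially by blast
  have int: "of_real r * (- u i - of_nat k) \<in> \<int>" if "k \<ge> k0" for k
    using pole_orbit(1)[OF i k0[OF that]] by (auto simp: denom_eq_0_iff intro: nonpos_Ints_Int)
  \<comment> \<open>Consecutive points of the orbit differ by 1, so the two integers obtained from
    them differ by r.\<close>
  have "of_real r * (- u i - of_nat k0) - of_real r * (- u i - of_nat (Suc k0)) \<in> \<int>"
    by (intro Ints_diff int) auto
  moreover have "of_real r * (- u i - of_nat k0) - of_real r * (- u i - of_nat (Suc k0)) = complex_of_real r"
    by (simp add: algebra_simps)
  ultimately have "complex_of_real r \<in> \<int>" by (simp only:)
  then show r: "r \<in> \<int>" by simp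
  have "- (of_real r * (- u i - of_nat k0)) - of_real r * of_nat k0 \<in> \<int>"
    using r by (intro Ints_diff Ints_minus Ints_mult int) auto
  then show "of_real r * u i \<in> \<int>" by (simp add: algebra_simps)
qed

text \<open>Shifting the argument changes neither degree nor leading coefficient, and U and V are
  monic of the same degree m. Up to this factor, R is the constant d.\<close>

lemma rational_factor_tendsto_1:
  "((\<lambda>w. poly P (w + 1) * poly Q w * U w / (poly P w * poly Q (w + 1) * V w)) \<longlongrightarrow> 1) at_infinity"
  "eventually (\<lambda>w. poly P w * poly Q (w + 1) * V w \<noteq> 0) at_infinity"
proof -
  let ?s = "[:1, 1:] :: complex poly"
  define N where "N = pcompose P ?s * Q * (\<Prod>i=1..m. [:u i, 1:])"
  define D where "D = P * pcompose Q ?s * (\<Prod>j=1..m. [:v j, 1:])"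
  have N: "poly N w = poly P (w + 1) * poly Q w * U w" and D: "poly D w = poly P w * poly Q (w + 1) * V w" for w
    by (simp_all add: N_def D_def U_def V_def poly_prod poly_pcompose add.commute)
  have comp: "pcompose R ?s \<noteq> 0" "degree (pcompose R ?s) = degree R"
    "lead_coeff (pcompose R ?s) = lead_coeff R" if "R \<noteq> 0" for R
    using that pcompose_eq_0[of R ?s] lead_coeff_comp[of ?s R] by (auto simp: degree_pcompose)
  have prods: "(\<Prod>i=1..m. [:c i, 1:]) \<noteq> 0" "degree (\<Prod>i=1..m. [:c i, 1:]) = m"
    "lead_coeff (\<Prod>i=1..m. [:c i, 1:]) = 1" for c :: "nat \<Rightarrow> complex"
    by (simp, simp add: degree_prod_eq_sum_degree, simp only: lead_coeff_prod, simp)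
  have nz: "N \<noteq> 0" "D \<noteq> 0"
    using P_nz Q_nz comp(1) prods(1) by (simp_all add: N_def D_def)
  have "degree N = degree D"
    unfolding N_def D_def using P_nz Q_nz comp prods by (simp add: degree_mult_eq)
  moreover have "lead_coeff N = lead_coeff D"
    unfolding N_def D_def lead_coeff_mult prods(3) comp(3)[OF P_nz] comp(3)[OF Q_nz] by (simp only: mult_ac)
  ultimately have "((\<lambda>w. poly N w / poly D w) \<longlongrightarrow> 1) at_infinity"
    using nz(1) by (rule poly_ratio_tendsto_1)
  then show "((\<lambda>w. poly P (w + 1) * poly Q w * U w / (poly P w * poly Q (w + 1) * V w)) \<longlongrightarrow> 1) at_infinity"
    by (simp only: N D)
  show "eventually (\<lambda>w. poly P w * poly Q (w + 1) * V w \<noteq> 0) at_infinity"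
    using poly_nonzero_at_infinity[OF nz(2)] by (simp only: D)
qed

lemma dilation_constant:
  "d = of_real (euler_peak p q (r - q) x / euler_peak 0 q (r - q) x)"
proof -
  let ?R = "\<lambda>w. poly P (w + 1) * poly Q w * U w / (poly P w * poly Q (w + 1) * V w)"
  let ?z = "\<lambda>n. 0 + complex_of_nat n"
  have "(\<lambda>n. d * ?R (?z n)) \<longlonglongrightarrow> d * 1"
    by (intro tendsto_mult tendsto_const
          filterlim_compose[OF rational_factor_tendsto_1(1) filterlim_add_of_nat_at_infinity(1)])
  moreover have "eventually (\<lambda>n. d * ?R (?z n) = f (0 + of_nat (Suc n)) / f (?z n)) sequentially"
  proof -
    have "eventually (\<lambda>n. poly P (?z n) * poly Q (?z n + 1) * V (?z n) \<noteq> 0) sequentially"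
      using rational_factor_tendsto_1(2) filterlim_add_of_nat_at_infinity(1)[of 0]
      unfolding filterlim_iff by blast
    moreover have "eventually (\<lambda>n. denom (?z (Suc n)) \<noteq> 0) sequentially"
      using eventually_denom_nonzero[of 0] by (subst eventually_sequentially_Suc)
    ultimately show ?thesis
      using eventually_denom_nonzero[of 0] eventually_numer_nonzero[of 0]
    proof eventually_elim
      case (elim n)
      have f: "f (?z n) = numer (?z n) / denom (?z n)"
        "f (0 + of_nat (Suc n)) = numer (?z n + 1) / denom (?z n + 1)"
        using f_eq[OF elim(2)] f_eq[OF elim(3)] by (simp_all add: add_ac)
      have den: "denom (?z n + 1) \<noteq> 0" using elim(2) by (simp add: add_ac)
      have ratio: "\<delta> * (A / B) = (n1 / e1) / (n0 / e0)"
        if "e0 \<noteq> 0" "e1 \<noteq> 0" "n0 \<noteq> 0" "B \<noteq> 0" "e0 * n1 * B = e1 * n0 * (\<delta> * A)"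
        for \<delta> A B n0 n1 e0 e1 :: complex
        using that by (simp add: field_simps)
      have "denom (?z n) * numer (?z n + 1) * (poly P (?z n) * poly Q (?z n + 1) * V (?z n)) =
          denom (?z n + 1) * numer (?z n) * (d * (poly P (?z n + 1) * poly Q (?z n) * U (?z n)))"
        using shift_identity[of "?z n", folded U_def V_def] by (simp only: mult_ac)
      then show ?case unfolding f by (rule ratio[OF elim(3) den elim(4) elim(1)])
    qed
  qed
  ultimately have "(\<lambda>n. f (0 + of_nat (Suc n)) / f (?z n)) \<longlonglongrightarrow> d * 1"
    by (rule Lim_transform_eventually)
  from LIMSEQ_unique[OF this f_ratio_tendsto] show ?thesis by simp
qed

text \<open>For integral r the functional equation of Gamma expresses denom w through denom (w + 1)
  and a polynomial. Cancelling the common factor leaves an identity between values of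
  \<open>numer\<close> that stays informative at the zeros of \<open>denom\<close>.\<close>

lemma numer_identity:
  assumes r: "r = real \<rho>"
  shows "pochhammer (of_real r * w) \<rho> * numer (w + 1) * (poly P w * poly Q (w + 1) * V w) =
         numer w * (d * (poly P (w + 1) * poly Q w * U w))"
proof (rule entire_cancel[of "\<lambda>w. denom (w + 1)"
    "\<lambda>w. pochhammer (of_real r * w) \<rho> * numer (w + 1) * (poly P w * poly Q (w + 1) * V w)"
    "\<lambda>w. numer w * (d * (poly P (w + 1) * poly Q w * U w))" 0 w])
  show "denom (0 + 1) \<noteq> 0" by (rule denom_nonzero) simp
  fix w :: complex
  have "of_real r * (w + 1) = of_real r * w + of_nat \<rho>" by (simp add: distrib_left r)
  then have "denom w = pochhammer (of_real r * w) \<rho> * denom (w + 1)"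
    unfolding denom_def by (simp only: pochhammer_rGamma[of "of_real r * w" \<rho>])
  then show "denom (w + 1) * (pochhammer (of_real r * w) \<rho> * numer (w + 1) * (poly P w * poly Q (w + 1) * V w)) =
      denom (w + 1) * (numer w * (d * (poly P (w + 1) * poly Q w * U w)))"
    using shift_identity[of w, folded U_def V_def] by (simp add: mult_ac)
qed (unfold pochhammer_prod, (intro holomorphic_intros holomorphic_shift holomorphic_numer
      holomorphic_denom holomorphic_U holomorphic_V)+)

text \<open>Up to a constant factor, \<open>(- 1) ^ n * numer z / fact n\<close> is the residue of \<^term>\<open>f\<close> at
  \<open>z = - n / r\<close>.\<close>

lemma residue_ratio_tendsto:
  assumes r: "r = real \<rho>" and z: "\<And>k. of_real r * z k = - of_nat (n0 + \<rho> * k)"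
    and nz: "\<And>k. numer (z k) \<noteq> 0"
  defines "T \<equiv> \<lambda>k. (- 1) ^ (n0 + \<rho> * k) * numer (z k) / fact (n0 + \<rho> * k)"
  shows "(\<lambda>k. T (Suc k) / T k) \<longlonglongrightarrow> 1 / d"
proof -
  let ?R = "\<lambda>w. poly P (w + 1) * poly Q w * U w / (poly P w * poly Q (w + 1) * V w)"
  have r0: "complex_of_real r \<noteq> 0" using r_pos by simp
  have z_step: "z (Suc k) + 1 = z k" for k
  proof -
    have "of_real r * (z (Suc k) + 1) = of_real r * z k"
      unfolding distrib_left z by (simp add: r algebra_simps)
    then show ?thesis using r0 by (simp only: mult_cancel_left) simp
  qed
  have z_eq: "z k = z 0 - of_nat k" for k
  proof (induction k)
    case (Suc k)
    have "z (Suc k) = z k - 1" using z_step[of k] by (simp only: eq_diff_eq)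
    also have "\<dots> = z 0 - of_nat (Suc k)" by (subst Suc) simp
    finally show ?case .
  qed simp
  have zinf: "filterlim z at_infinity sequentially"
    by (subst z_eq[abs_def]) (rule filterlim_add_of_nat_at_infinity(2))
  \<comment> \<open>The index k runs to the left while the identity steps to the right, hence the
    reciprocal of d.\<close>
  have lim: "(\<lambda>k. 1 / (d * ?R (z (Suc k)))) \<longlonglongrightarrow> 1 / (d * 1)"
    using d_nz filterlim_compose[OF rational_factor_tendsto_1(1) zinf]
    by (intro tendsto_divide tendsto_mult tendsto_const LIMSEQ_Suc) auto
  have "eventually (\<lambda>k. poly P (z k) * poly Q (z k + 1) * V (z k) \<noteq> 0) sequentially"
    using rational_factor_tendsto_1(2) zinf unfolding filterlim_iff by blast
  then have "eventually (\<lambda>k. poly P (z (Suc k)) * poly Q (z (Suc k) + 1) * V (z (Suc k)) \<noteq> 0) sequentially"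
    by (subst eventually_sequentially_Suc)
  then have "eventually (\<lambda>k. 1 / (d * ?R (z (Suc k))) = T (Suc k) / T k) sequentially"
  proof eventually_elim
    case (elim k)
    define n where "n = n0 + \<rho> * k"
    let ?D = "poly P (z (Suc k)) * poly Q (z (Suc k) + 1) * V (z (Suc k))"
    let ?N = "poly P (z (Suc k) + 1) * poly Q (z (Suc k)) * U (z (Suc k))"
    have n: "n0 + \<rho> * Suc k = n + \<rho>" by (simp add: n_def)
    have "pochhammer (- of_nat (n + \<rho>)) \<rho> * numer (z k) * ?D = numer (z (Suc k)) * (d * ?N)"
      using numer_identity[OF r, of "z (Suc k)"] unfolding z n z_step .
    then have "(- 1) ^ \<rho> * (fact (n + \<rho>) / fact n) * numer (z k) * ?D = numer (z (Suc k)) * (d * ?N)"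
      unfolding pochhammer_minus_of_nat_add .
    then have key: "d * ?N = (- 1) ^ \<rho> * (fact (n + \<rho>) / fact n) * numer (z k) * ?D / numer (z (Suc k))"
      using nz[of "Suc k"] by (simp add: field_simps)
    have "1 / (d * (?N / ?D)) = ?D / (d * ?N)" by simp
    also have "\<dots> = numer (z (Suc k)) / ((- 1) ^ \<rho> * (fact (n + \<rho>) / fact n) * numer (z k))"
      unfolding key using elim nz by simp
    also have "\<dots> = T (Suc k) / T k"
    proof -
      have "(- 1) ^ \<rho> * (- 1) ^ \<rho> = (1 :: complex)" by (simp flip: power_mult_distrib)
      then have "(- 1) ^ \<rho> * ((- 1) ^ \<rho> * y) = y" for y :: complex
        by (simp only: mult.assoc[symmetric] mult_1)
      then show ?thesis
        unfolding T_def n n_def[symmetric] using nz[of k] by (simp add: field_simps power_add)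
    qed
    finally show ?case .
  qed
  with lim have "(\<lambda>k. T (Suc k) / T k) \<longlonglongrightarrow> 1 / (d * 1)" by (rule Lim_transform_eventually)
  then show ?thesis by simp
qed

end

subsection \<open>Asymptotics of the residues\<close>

lemma euler_integral_Beta:
  assumes "0 < B" "0 < S" "\<bar>x\<bar> < 1"
  shows "euler_integral 0 (of_real B) (of_real S) x = of_real (Beta B S)"
proof -
  have "((\<lambda>t. complex_of_real (t powr (B - 1) * (1 - t) powr (S - 1))) has_integral of_real (Beta B S)) {0..1}"
    by (intro has_integral_of_real has_integral_Beta_real assms)
  moreover have "complex_of_real (t powr (B - 1) * (1 - t) powr (S - 1))
      = euler_integrand 0 (of_real B) (of_real S) x t" if "t \<in> {0..1}" for t
  proof -
    have "complex_of_real (t powr (B - 1)) = of_real t powr (of_real B - 1)"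
      "complex_of_real ((1 - t) powr (S - 1)) = of_real (1 - t) powr (of_real S - 1)"
      using that powr_of_real[of t "B - 1"] powr_of_real[of "1 - t" "S - 1"] by simp_all
    then show ?thesis unfolding euler_integrand_0[OF assms(3) that] of_real_mult by (simp only:)
  qed
  ultimately have "(euler_integrand 0 (of_real B) (of_real S) x has_integral of_real (Beta B S)) {0..1}"
    using has_integral_cong[of "{0..1}" "\<lambda>t. complex_of_real (t powr (B - 1) * (1 - t) powr (S - 1))"
      "euler_integrand 0 (of_real B) (of_real S) x"] by blast
  then show ?thesis unfolding euler_integral_def by (rule integral_unique)
qed

text \<open>The symbol is Gamma(n + 1 - t) / Gamma(-t). Reflection replaces 1 / Gamma(-t) by a sine
  times Gamma(1 + t), and division by Gamma(n + 2) completes a Beta value. All oscillation is thus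
  in the sine, and Laplace's method applies to the rest.\<close>

lemma pochhammer_euler_integral:
  assumes t: "0 < t" "t < real n + 1" and x: "\<bar>x\<bar> < 1"
  shows "pochhammer (- of_real t) (Suc n) / fact (Suc n) =
    of_real (- sin (pi * t) / pi) * euler_integral 0 (1 + of_real t) (of_nat (Suc n) - of_real t) x"
proof -
  let ?z = "- complex_of_real t"
  have G: "Gamma (1 - ?z) = of_real (Gamma (1 + t))" "Gamma (?z + of_nat (Suc n)) = of_real (Gamma (real (Suc n) - t))"
    using Gamma_complex_of_real[of "1 + t"] Gamma_complex_of_real[of "real (Suc n) - t"] by simp_all
  have pos: "0 < Gamma (1 + t)" "0 < Gamma (real (Suc n) - t)"
    using t by (auto intro!: Gamma_real_pos)
  have "rGamma ?z * rGamma (1 - ?z) = sin (of_real pi * ?z) / of_real pi"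
    by (rule rGamma_reflection_complex)
  also have "sin (of_real pi * ?z) / of_real pi = of_real (- sin (pi * t) / pi)"
    by (simp add: sin_of_real flip: of_real_mult)
  finally have refl: "rGamma ?z = of_real (- sin (pi * t) / pi) * of_real (Gamma (1 + t))"
    using pos(1) unfolding rGamma_inverse_Gamma[of "1 - ?z"] G by (simp add: field_simps)
  have "rGamma ?z = pochhammer ?z (Suc n) * rGamma (?z + of_nat (Suc n))"
    by (rule pochhammer_rGamma)
  then have "pochhammer ?z (Suc n) = rGamma ?z * of_real (Gamma (real (Suc n) - t))"
    using pos(2) unfolding rGamma_inverse_Gamma[of "?z + of_nat (Suc n)"] G by (simp add: field_simps del: of_nat_Suc)
  moreover have "fact (Suc n) = complex_of_real (Gamma (1 + t + (real (Suc n) - t)))"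
    using Gamma_fact[of "Suc n", where 'a = real] by simp
  ultimately have "pochhammer ?z (Suc n) / fact (Suc n) =
      of_real (- sin (pi * t) / pi) * of_real (Beta (1 + t) (real (Suc n) - t))"
    unfolding refl Beta_def by (simp add: mult_ac del: of_nat_Suc fact_Suc)
  also have "of_real (Beta (1 + t) (real (Suc n) - t)) =
      euler_integral 0 (of_real (1 + t)) (of_real (real (Suc n) - t)) x"
    using t x by (intro euler_integral_Beta[symmetric]) auto
  finally show ?thesis by (simp del: of_nat_Suc fact_Suc)
qed

context gauss_parameters
begin

text \<open>The reflection formula turns the two Pochhammer symbols in the value of \<^term>\<open>numer\<close> at a zero of
  \<^term>\<open>denom\<close> into sines times the beta integrals \<open>A k\<close> and \<open>B k\<close> of the proof.\<close>

lemma residue_asymptotics: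
  fixes \<alpha> \<beta> :: real and z :: "nat \<Rightarrow> complex" and n0 \<rho> :: nat
  assumes r: "r = real \<rho>"
    and z: "\<And>k. of_real r * z k = - of_nat (n0 + \<rho> * k)"
    and za: "\<And>k. of_real p * z k + of_real a = - of_real (\<alpha> + p * real k)"
    and zb: "\<And>k. of_real q * z k + of_real b = - of_real (\<beta> + q * real k)"
  defines "T \<equiv> \<lambda>k. (- 1) ^ (n0 + \<rho> * k) * numer (z k) / fact (n0 + \<rho> * k)"
  obtains W where
    "eventually (\<lambda>k. T k = of_real (sin (pi * (\<alpha> + p * real k)) * sin (pi * (\<beta> + q * real k))) * W k) sequentially"
    "eventually (\<lambda>k. W k \<noteq> 0) sequentially"
    "(\<lambda>k. W (Suc k) / W k) \<longlonglongrightarrow> of_real ((- 1) ^ \<rho> * x ^ \<rho> *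
        euler_peak 0 p (r - p) x * euler_peak 0 q (r - q) x *
        (euler_peak (r - p) (r - q) q x / euler_peak 0 (r - q) q x))"
proof -
  define n where "n k = n0 + \<rho> * k" for k
  define A where "A k = euler_integral (0 + of_real 0 * of_nat k) (1 + of_real \<alpha> + of_real p * of_nat k)
      (of_nat (Suc n0) - of_real \<alpha> + of_real (r - p) * of_nat k) x" for k
  define B where "B k = euler_integral (0 + of_real 0 * of_nat k) (1 + of_real \<beta> + of_real q * of_nat k)
      (of_nat (Suc n0) - of_real \<beta> + of_real (r - q) * of_nat k) x" for k
  \<comment> \<open>The Gauss function supplied by \<open>reg_2F1_minus_of_nat\<close>. Since n k
    grows by r per step, its parameters grow by r - p, r - q and r: the dual triple.\<close>
  define F where "F k = gauss_2F1 (of_nat (Suc n0) - of_real \<alpha> + of_real (r - p) * of_nat k)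
      (of_nat (Suc n0) - of_real \<beta> + of_real (r - q) * of_nat k)
      (of_nat (n0 + 2) + of_real r * of_nat k) (of_real x)" for k
  define W where "W k = (- 1) ^ n k * of_nat (Suc (n k)) * of_real x ^ Suc (n k) * (A k * B k * F k) / of_real (pi\<^sup>2)"
    for k
  have rp: "0 < r - p" "0 < r - q" "r - q < r" using p q by auto
  have rq: "r - (r - q) = q" by simp
  note asA = euler_integral_asymptotics[OF abs_x p(1) rp(1),
      of 0 0 "1 + of_real \<alpha>" "of_nat (Suc n0) - of_real \<alpha>", folded A_def]
  note asB = euler_integral_asymptotics[OF abs_x q(1) rp(2),
      of 0 0 "1 + of_real \<beta>" "of_nat (Suc n0) - of_real \<beta>", folded B_def]
  note asF = gauss_2F1_asymptotics[OF abs_x rp(2,3), of "of_nat (Suc n0) - of_real \<alpha>" "r - p"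
      "of_nat (Suc n0) - of_real \<beta>" "of_nat (n0 + 2)", folded F_def, unfolded rq]
  have n: "of_nat (n k) = (of_nat n0 + of_real r * of_nat k :: complex)"
    "real (n k) = real n0 + r * real k" for k
    by (simp_all add: n_def r)
  \<comment> \<open>The four eventual inequalities place \<alpha> + p k and \<beta> + q k strictly
    between 0 and n k + 1, the range in which the Beta representation holds.\<close>
  have T: "eventually (\<lambda>k. T k = of_real (sin (pi * (\<alpha> + p * real k)) * sin (pi * (\<beta> + q * real k))) * W k) sequentially"
    using eventually_linear_gt[OF p(1), of \<alpha>] eventually_linear_gt[OF q(1), of \<beta>]
      eventually_linear_gt[OF rp(1), of "real n0 + 1 - \<alpha>"] eventually_linear_gt[OF rp(2), of "real n0 + 1 - \<beta>"]
  proof eventually_elim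
    case (elim k)
    let ?sa = "of_real (- sin (pi * (\<alpha> + p * real k)) / pi) :: complex"
    let ?sb = "of_real (- sin (pi * (\<beta> + q * real k)) / pi) :: complex"
    have "pochhammer (- of_real (\<alpha> + p * real k)) (Suc (n k)) / fact (Suc (n k)) = ?sa * A k"
      using pochhammer_euler_integral[OF elim(1) _ abs_x, of "n k"] elim(3)
      by (simp add: A_def n algebra_simps)
    then have pa: "pochhammer (- of_real (\<alpha> + p * real k)) (Suc (n k)) = ?sa * A k * fact (Suc (n k))"
      by (simp add: divide_eq_eq del: fact_Suc)
    have "pochhammer (- of_real (\<beta> + q * real k)) (Suc (n k)) / fact (Suc (n k)) = ?sb * B k"
      using pochhammer_euler_integral[OF elim(2) _ abs_x, of "n k"] elim(4)
      by (simp add: B_def n algebra_simps)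
    then have pb: "pochhammer (- of_real (\<beta> + q * real k)) (Suc (n k)) = ?sb * B k * fact (Suc (n k))"
      by (simp add: divide_eq_eq del: fact_Suc)
    have F: "gauss_2F1 (- of_real (\<alpha> + p * real k) + of_nat (Suc (n k)))
        (- of_real (\<beta> + q * real k) + of_nat (Suc (n k))) (of_nat (n k + 2)) (of_real x) = F k"
      by (simp add: F_def n algebra_simps)
    have "numer (z k) = pochhammer (- of_real (\<alpha> + p * real k)) (Suc (n k)) *
        pochhammer (- of_real (\<beta> + q * real k)) (Suc (n k)) / fact (Suc (n k)) * of_real x ^ Suc (n k) * F k"
      unfolding numer_def za zb z F[symmetric] n_def[symmetric] by (rule reg_2F1_minus_of_nat[OF norm_x])
    also have "\<dots> = ?sa * A k * (?sb * B k) * fact (Suc (n k)) * of_real x ^ Suc (n k) * F k"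
      unfolding pa pb by (simp add: field_simps del: fact_Suc)
    finally have num: "numer (z k) = ?sa * ?sb * (A k * B k * F k) * of_real x ^ Suc (n k) * fact (Suc (n k))"
      by (simp only: mult_ac)
    have "numer (z k) / fact (n k) = ?sa * ?sb * (A k * B k * F k) * of_real x ^ Suc (n k) * of_nat (Suc (n k))"
      unfolding num by (simp add: field_simps)
    moreover have "?sa * ?sb = of_real (sin (pi * (\<alpha> + p * real k)) * sin (pi * (\<beta> + q * real k))) / of_real (pi\<^sup>2)"
      by (simp add: power2_eq_square)
    ultimately have "T k = (- 1) ^ n k * (of_real (sin (pi * (\<alpha> + p * real k)) * sin (pi * (\<beta> + q * real k))) / of_real (pi\<^sup>2)
        * (A k * B k * F k) * of_real x ^ Suc (n k) * of_nat (Suc (n k)))"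
      unfolding T_def n_def[symmetric] times_divide_eq_right[symmetric] by (simp only:)
    then show ?case by (simp only: W_def mult_ac times_divide_eq_right times_divide_eq_left)
  qed
  have x0: "complex_of_real x \<noteq> 0" using x by simp
  have W0: "eventually (\<lambda>k. W k \<noteq> 0) sequentially"
    using asA(1) asB(1) asF(1)
    by eventually_elim (use x0 in \<open>simp add: W_def del: of_nat_Suc\<close>)
  have "(\<lambda>k. of_real (real (Suc (n (Suc k))) / real (Suc (n k))) :: complex) \<longlonglongrightarrow> of_real 1"
  proof (rule tendsto_of_real)
    have "r > 0" by (rule r_pos)
    then have "((\<lambda>k::nat. (real n0 + r * (real k + 1) + 1) / (real n0 + r * real k + 1)) \<longlongrightarrow> 1) sequentially"
      by real_asymp
    then show "(\<lambda>k. real (Suc (n (Suc k))) / real (Suc (n k))) \<longlonglongrightarrow> 1"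
      by (simp add: n add_ac)
  qed
  note lim_n = this
  have "(\<lambda>k. (- 1) ^ \<rho> * of_real (real (Suc (n (Suc k))) / real (Suc (n k))) * of_real x ^ \<rho> *
        ((A (Suc k) / A k) * (B (Suc k) / B k) * (F (Suc k) / F k))) \<longlonglongrightarrow>
      (- 1) ^ \<rho> * of_real 1 * of_real x ^ \<rho> * (of_real (euler_peak 0 p (r - p) x) *
        of_real (euler_peak 0 q (r - q) x) * of_real (euler_peak (r - p) (r - q) q x / euler_peak 0 (r - q) q x))"
    by (intro tendsto_mult tendsto_const lim_n asA(2) asB(2) asF(2))
  moreover have "eventually (\<lambda>k. (- 1) ^ \<rho> * of_real (real (Suc (n (Suc k))) / real (Suc (n k))) * of_real x ^ \<rho> *
        ((A (Suc k) / A k) * (B (Suc k) / B k) * (F (Suc k) / F k)) = W (Suc k) / W k) sequentially"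
    using W0
  proof eventually_elim
    case (elim k)
    have nS: "n (Suc k) = n k + \<rho>" by (simp add: n_def)
    show ?case
      using elim x0 unfolding W_def nS power_add by (simp add: power_add field_simps del: of_nat_Suc)
  qed
  ultimately have "(\<lambda>k. W (Suc k) / W k) \<longlonglongrightarrow>
      (- 1) ^ \<rho> * of_real 1 * of_real x ^ \<rho> * (of_real (euler_peak 0 p (r - p) x) *
        of_real (euler_peak 0 q (r - q) x) * of_real (euler_peak (r - p) (r - q) q x / euler_peak 0 (r - q) q x))"
    by (rule Lim_transform_eventually)
  then have "(\<lambda>k. W (Suc k) / W k) \<longlonglongrightarrow> of_real ((- 1) ^ \<rho> * x ^ \<rho> *
        euler_peak 0 p (r - p) x * euler_peak 0 q (r - q) x *
        (euler_peak (r - p) (r - q) q x / euler_peak 0 (r - q) q x))"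
    by (simp add: mult_ac)
  with T W0 show thesis by (rule that)
qed

end

subsection \<open>Arithmetic consequences\<close>

context gauss_gamma_product
begin

text \<open>The residue factors as sine product times W. Its ratios tend to 1 / d and those of W to
  a limit \<open>\<omega>\<close>, so the sine ratios tend to 1 / (d * \<omega>), into which
  \<open>dilation_constant\<close> is inserted.\<close>

lemma sine_ratio_tendsto:
  assumes i: "i \<in> {1..m}" and r: "r = real \<rho>"
  obtains k0 :: nat and \<alpha> \<beta> :: real where
    "of_real p * u i - of_real a = of_real \<alpha>" "of_real q * u i - of_real b = of_real \<beta>"
    "eventually (\<lambda>k. sin (pi * (\<alpha> + p * k0 + p * real k)) * sin (pi * (\<beta> + q * k0 + q * real k)) \<noteq> 0) sequentially"
    "(\<lambda>k. (sin (pi * (\<alpha> + p * k0 + p * real (Suc k))) * sin (pi * (\<beta> + q * k0 + q * real (Suc k)))) /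
          (sin (pi * (\<alpha> + p * k0 + p * real k)) * sin (pi * (\<beta> + q * k0 + q * real k)))) \<longlonglongrightarrow>
       euler_peak 0 q (r - q) x / (euler_peak p q (r - q) x * ((- 1) ^ \<rho> * x ^ \<rho> *
          euler_peak 0 p (r - p) x * euler_peak (r - p) (r - q) q x))"
proof -
  \<comment> \<open>From k0 on the orbit avoids the zeros of P and \<open>pole_orbit\<close>
    applies. The offset stays in the sine arguments, so that \<alpha> and \<beta> remain p u i - a
    and q u i - b.\<close>
  obtain k0 where k0: "\<And>k. k \<ge> k0 \<Longrightarrow> poly P (- u i - of_nat k) \<noteq> 0"
    using eventually_poly_nonzero(2)[OF P_nz, of "- u i"] unfolding eventually_sequentially by blast
  obtain n0 where "of_real r * (- u i - of_nat k0) = - of_nat n0"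
    using pole_orbit(1)[OF i k0[OF order_refl]] by (auto simp: denom_eq_0_iff elim!: nonpos_Ints_cases')
  then have "of_real r * u i = of_nat n0 - of_real r * of_nat k0" by (simp add: algebra_simps)
  then have ui: "u i = of_real (real n0 / r - real k0)"
    using r_pos by (simp add: field_simps)
  define \<alpha> where "\<alpha> = p * (real n0 / r - real k0) - a"
  define \<beta> where "\<beta> = q * (real n0 / r - real k0) - b"
  define z where "z k = - u i - of_nat (k0 + k)" for k
  define s where "s k = sin (pi * (\<alpha> + p * k0 + p * real k)) * sin (pi * (\<beta> + q * k0 + q * real k))" for k
  have z: "z k = of_real (- (real n0 / r) - real k)" for k
    by (simp add: z_def ui)
  have rz: "of_real r * z k = - of_nat (n0 + \<rho> * k)" for k
  proof -
    have "r * (- (real n0 / r) - real k) = - real (n0 + \<rho> * k)"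
      using r_pos by (simp add: r field_simps)
    then show ?thesis
      unfolding z of_real_mult[symmetric] by (simp only: of_real_minus of_real_of_nat_eq)
  qed
  have za: "of_real p * z k + of_real a = - of_real (\<alpha> + p * k0 + p * real k)"
    and zb: "of_real q * z k + of_real b = - of_real (\<beta> + q * k0 + q * real k)" for k
    by (simp_all add: z \<alpha>_def \<beta>_def algebra_simps)
  have nz: "numer (z k) \<noteq> 0" for k
    unfolding z_def by (intro pole_orbit(2)[OF i] k0) simp
  define T where "T k = (- 1) ^ (n0 + \<rho> * k) * numer (z k) / fact (n0 + \<rho> * k)" for k
  have T0: "T k \<noteq> 0" for k using nz by (simp add: T_def)
  obtain W where W: "eventually (\<lambda>k. T k = of_real (s k) * W k) sequentially"
    "eventually (\<lambda>k. W k \<noteq> 0) sequentially"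
    "(\<lambda>k. W (Suc k) / W k) \<longlonglongrightarrow> of_real ((- 1) ^ \<rho> * x ^ \<rho> *
        euler_peak 0 p (r - p) x * euler_peak 0 q (r - q) x *
        (euler_peak (r - p) (r - q) q x / euler_peak 0 (r - q) q x))"
    using residue_asymptotics[OF r rz za zb] unfolding T_def[symmetric] s_def[symmetric] by blast
  have s0: "eventually (\<lambda>k. s k \<noteq> 0) sequentially"
    using W(1) by eventually_elim (use T0 in auto)
  have pos: "0 < euler_peak c e g x" if "0 < e" "0 < g" for c e g
    using that abs_x by (rule euler_peak_pos)
  have rp: "0 < r - p" "0 < r - q" using p q by auto
  \<comment> \<open>By this symmetry the growth of the Beta integral for q cancels against the
    normalising Beta integral of the Gauss factor.\<close>
  have sym: "euler_peak 0 (r - q) q x = euler_peak 0 q (r - q) x"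
    using euler_peak_0[OF q(1) rp(2) abs_x] euler_peak_0[OF rp(2) q(1) abs_x] by (simp add: mult.commute)
  define \<omega> where "\<omega> = (- 1) ^ \<rho> * x ^ \<rho> * euler_peak 0 p (r - p) x * euler_peak (r - p) (r - q) q x"
  have \<omega>0: "\<omega> \<noteq> 0" using x pos[OF p(1) rp(1)] pos[OF rp(2) q(1)] by (simp add: \<omega>_def less_imp_neq[symmetric])
  have limW: "(\<lambda>k. W (Suc k) / W k) \<longlonglongrightarrow> of_real \<omega>"
    using W(3) pos[OF q(1) rp(2), of 0] by (simp add: sym \<omega>_def less_imp_neq[symmetric] mult_ac)
  have limT: "(\<lambda>k. T (Suc k) / T k) \<longlonglongrightarrow> 1 / d"
    unfolding T_def by (rule residue_ratio_tendsto[OF r rz nz])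
  have "(\<lambda>k. (T (Suc k) / T k) / (W (Suc k) / W k)) \<longlonglongrightarrow> (1 / d) / of_real \<omega>"
    using limT limW by (rule tendsto_divide) (use \<omega>0 in simp)
  moreover have "eventually (\<lambda>k. (T (Suc k) / T k) / (W (Suc k) / W k) = of_real (s (Suc k) / s k)) sequentially"
    using W(1,2) eventually_sequentially_Suc[THEN iffD2, OF W(1)]
      eventually_sequentially_Suc[THEN iffD2, OF W(2)]
    by eventually_elim (simp add: field_simps)
  ultimately have "(\<lambda>k. complex_of_real (s (Suc k) / s k)) \<longlonglongrightarrow> (1 / d) / of_real \<omega>"
    by (rule Lim_transform_eventually)
  also have "(1 / d) / of_real \<omega> = of_real (euler_peak 0 q (r - q) x / (euler_peak p q (r - q) x * \<omega>))"
    unfolding dilation_constant by simp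
  finally have "(\<lambda>k. s (Suc k) / s k) \<longlonglongrightarrow> euler_peak 0 q (r - q) x / (euler_peak p q (r - q) x * \<omega>)"
    by (simp only: tendsto_of_real_iff)
  with s0 show thesis
    unfolding s_def \<omega>_def by (intro that) (simp_all add: ui \<alpha>_def \<beta>_def)
qed

text \<open>Absolute value 1 of the sine limit means
  \<open>mq = M * M' * mp * \<bar>x\<bar> ^ \<rho>\<close>. For x < 0 this fails: M and M' are at
  most mq < 1, and the remaining factors are below 1. For x > 0 the limit is the bare sign
  (-1)^\<rho>, and duality expresses M' through M.\<close>

lemma peak_equation:
  assumes i: "i \<in> {1..m}" and r: "r = real \<rho>"
  shows "0 < x"
    and "euler_peak 0 q (r - q) x = x ^ \<rho> * euler_peak 0 p (r - p) x *
           (1 - x) powr (p + q - r) * (euler_peak p q (r - q) x)\<^sup>2"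
    and "euler_peak 0 q (r - q) x / (euler_peak p q (r - q) x * ((- 1) ^ \<rho> * x ^ \<rho> *
          euler_peak 0 p (r - p) x * euler_peak (r - p) (r - q) q x)) = (- 1) ^ \<rho>"
proof -
  define M where "M = euler_peak p q (r - q) x"
  define M' where "M' = euler_peak (r - p) (r - q) q x"
  define mq where "mq = euler_peak 0 q (r - q) x"
  define mp where "mp = euler_peak 0 p (r - p) x"
  note defs = M_def[symmetric] M'_def[symmetric] mq_def[symmetric] mp_def[symmetric]
  have rp: "0 < r - p" "0 < r - q" using p q by auto
  have pos: "0 < M" "0 < M'" "0 < mq" "0 < mp"
    unfolding M_def M'_def mq_def mp_def using p q rp abs_x by (auto intro!: euler_peak_pos)
  obtain k0 :: nat and \<alpha> \<beta> where
    nz: "eventually (\<lambda>k. sin (pi * (\<alpha> + p * k0 + p * real k)) * sin (pi * (\<beta> + q * k0 + q * real k)) \<noteq> 0) sequentially"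
    and lim: "(\<lambda>k. (sin (pi * (\<alpha> + p * k0 + p * real (Suc k))) * sin (pi * (\<beta> + q * k0 + q * real (Suc k)))) /
          (sin (pi * (\<alpha> + p * k0 + p * real k)) * sin (pi * (\<beta> + q * k0 + q * real k)))) \<longlonglongrightarrow>
       mq / (M * ((- 1) ^ \<rho> * x ^ \<rho> * mp * M'))"
    by (rule sine_ratio_tendsto[OF i r, unfolded defs]) (rule that)
  have abs_1: "\<bar>mq / (M * ((- 1) ^ \<rho> * x ^ \<rho> * mp * M'))\<bar> = 1"
    by (rule sin_product_ratio_limit(1)[OF refl nz lim])
  then have eq: "mq = M * M' * mp * \<bar>x\<bar> ^ \<rho>"
    using pos x(3) by (simp add: abs_mult abs_divide power_abs field_simps)
  show x_pos: "0 < x"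
  proof (rule ccontr)
    assume "\<not> 0 < x"
    then have neg: "x < 0" using x by simp
    have sym: "euler_peak 0 (r - q) q x = mq"
      unfolding mq_def using euler_peak_0[OF q(1) rp(2) abs_x] euler_peak_0[OF rp(2) q(1) abs_x]
      by (simp add: mult.commute)
    have "M \<le> mq" unfolding M_def mq_def
      using p q rp x neg by (intro euler_peak_mono_neg) auto
    moreover have "M' \<le> mq" unfolding M'_def sym[symmetric]
      using p q rp x neg by (intro euler_peak_mono_neg) auto
    moreover have m1: "mq < 1" "mp < 1"
      unfolding mq_def mp_def using p q rp abs_x by (auto intro!: euler_peak_0_less_1)
    ultimately have "M * M' \<le> mq * 1" using pos by (intro mult_mono) auto
    moreover have "mp * \<bar>x\<bar> ^ \<rho> < 1"
    proof -
      have "mp * \<bar>x\<bar> ^ \<rho> \<le> mp * 1" using abs_x pos by (intro mult_left_mono power_le_one) auto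
      then show ?thesis using m1 by simp
    qed
    then have "M * M' * (mp * \<bar>x\<bar> ^ \<rho>) < M * M' * 1"
      using pos by (intro mult_strict_left_mono) auto
    ultimately show False using eq by (simp add: mult.assoc)
  qed
  have "mq \<noteq> 0" "M * M' * mp * x ^ \<rho> = mq" using pos eq x_pos by auto
  moreover have "mq / (M * ((- 1) ^ \<rho> * x ^ \<rho> * mp * M')) = mq / ((- 1) ^ \<rho> * (M * M' * mp * x ^ \<rho>))"
    by (simp only: mult_ac)
  ultimately have "mq / (M * ((- 1) ^ \<rho> * x ^ \<rho> * mp * M')) = 1 / (- 1) ^ \<rho>" by simp
  also have "\<dots> = (- 1) ^ \<rho>" by (cases "even \<rho>") auto
  finally show "euler_peak 0 q (r - q) x / (euler_peak p q (r - q) x * ((- 1) ^ \<rho> * x ^ \<rho> *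
          euler_peak 0 p (r - p) x * euler_peak (r - p) (r - q) q x)) = (- 1) ^ \<rho>"
    unfolding defs .
  have "M' = (1 - x) powr (p + q - r) * M"
    unfolding M_def M'_def using euler_peak_dual[OF q(1) rp(2) abs_x, of p] by (simp add: algebra_simps)
  then show "euler_peak 0 q (r - q) x = x ^ \<rho> * euler_peak 0 p (r - p) x *
           (1 - x) powr (p + q - r) * (euler_peak p q (r - q) x)\<^sup>2"
    unfolding defs using eq x_pos by (simp add: power2_eq_square mult_ac)
qed

text \<open>d = M / mq, and the second part of \<open>peak_equation\<close> turns the radicand into
  the square of r^r mq / M.\<close>

lemma dilation_constant_closed_form:
  assumes i: "i \<in> {1..m}" and r: "r = real \<rho>"
  shows "d = complex_of_real (r powr r /
          sqrt (p powr p * q powr q * (r - p) powr (r - p) * (r - q) powr (r - q) *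
                x powi \<lfloor>r\<rfloor> * (1 - x) powr (p + q - r)))"
proof -
  define M where "M = euler_peak p q (r - q) x"
  define mq where "mq = euler_peak 0 q (r - q) x"
  define mp where "mp = euler_peak 0 p (r - p) x"
  have rp: "0 < r - p" "0 < r - q" using p q by auto
  have pos: "0 < M" "0 < mq" "0 < mp" "0 < r powr r"
    unfolding M_def mq_def mp_def using p q rp abs_x r_pos by (auto intro!: euler_peak_pos)
  have powi: "x powi \<lfloor>r\<rfloor> = x ^ \<rho>" by (simp add: r)
  have "mq * r powr r = q powr q * (r - q) powr (r - q)" "mp * r powr r = p powr p * (r - p) powr (r - p)"
    unfolding mq_def mp_def using euler_peak_0[OF q(1) rp(2) abs_x] euler_peak_0[OF p(1) rp(1) abs_x] r_pos
    by simp_all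
  then have "p powr p * q powr q * (r - p) powr (r - p) * (r - q) powr (r - q) * x powi \<lfloor>r\<rfloor> * (1 - x) powr (p + q - r)
      = (mp * r powr r) * (mq * r powr r) * x ^ \<rho> * (1 - x) powr (p + q - r)"
    unfolding powi by (simp only: mult_ac)
  also have "\<dots> = (r powr r)\<^sup>2 * mq * (x ^ \<rho> * mp * (1 - x) powr (p + q - r))"
    by (simp only: power2_eq_square mult_ac)
  also have "x ^ \<rho> * mp * (1 - x) powr (p + q - r) = mq / M\<^sup>2"
    using peak_equation(2)[OF i r] pos unfolding M_def[symmetric] mq_def[symmetric] mp_def[symmetric]
    by (simp add: field_simps)
  also have "(r powr r)\<^sup>2 * mq * (mq / M\<^sup>2) = (r powr r * mq / M)\<^sup>2"
    by (simp add: power2_eq_square)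
  finally have "sqrt (p powr p * q powr q * (r - p) powr (r - p) * (r - q) powr (r - q) *
                x powi \<lfloor>r\<rfloor> * (1 - x) powr (p + q - r)) = r powr r * mq / M"
    using pos by simp
  then show ?thesis
    unfolding dilation_constant M_def[symmetric] mq_def[symmetric] using pos by simp
qed

text \<open>The sine limit is now (-1)^\<rho>, so its comparison with cos (pi (p + q)) reads off the
  parity of p + q + r. That the sines do not vanish for large k forbids integral \<alpha> and
  \<beta>.\<close>

lemma exponent_dichotomy:
  assumes i: "i \<in> {1..m}" and r: "r = real \<rho>"
  obtains \<alpha> \<beta> :: real where
    "of_real p * u i - of_real a = of_real \<alpha>" "of_real q * u i - of_real b = of_real \<beta>"
    "\<alpha> \<notin> \<int>" "\<beta> \<notin> \<int>"
    "(p \<in> \<int> \<and> q \<in> \<int> \<and> even \<lfloor>p + q + r\<rfloor>) \<or>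
     (p - 1 / 2 \<in> \<int> \<and> q - 1 / 2 \<in> \<int> \<and>
       (even \<lfloor>p + q + r\<rfloor> \<and> \<alpha> - \<beta> - 1 / 2 \<in> \<int> \<or> odd \<lfloor>p + q + r\<rfloor> \<and> \<alpha> + \<beta> - 1 / 2 \<in> \<int>))"
proof -
  obtain k0 :: nat and \<alpha> \<beta> where
    \<alpha>: "of_real p * u i - of_real a = of_real \<alpha>" and \<beta>: "of_real q * u i - of_real b = of_real \<beta>"
    and nz: "eventually (\<lambda>k. sin (pi * (\<alpha> + p * k0 + p * real k)) * sin (pi * (\<beta> + q * k0 + q * real k)) \<noteq> 0) sequentially"
    and lim: "(\<lambda>k. (sin (pi * (\<alpha> + p * k0 + p * real (Suc k))) * sin (pi * (\<beta> + q * k0 + q * real (Suc k)))) /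
          (sin (pi * (\<alpha> + p * k0 + p * real k)) * sin (pi * (\<beta> + q * k0 + q * real k)))) \<longlonglongrightarrow> (- 1) ^ \<rho>"
    by (rule sine_ratio_tendsto[OF i r, unfolded peak_equation(3)[OF i r]]) (rule that)
  have cases: "(p \<in> \<int> \<and> q \<in> \<int> \<and> cos (pi * (p + q)) = (- 1) ^ \<rho>) \<or>
         (p - 1 / 2 \<in> \<int> \<and> q - 1 / 2 \<in> \<int> \<and>
           (cos (pi * (p + q)) = (- 1) ^ \<rho> \<and> \<alpha> + p * k0 - (\<beta> + q * k0) - 1 / 2 \<in> \<int> \<or>
            cos (pi * (p + q)) = - ((- 1) ^ \<rho>) \<and> \<alpha> + p * k0 + (\<beta> + q * k0) - 1 / 2 \<in> \<int>))"
    by (rule sin_product_ratio_limit(2)[OF refl nz lim])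
  have two: "2 * p \<in> \<int>" "2 * q \<in> \<int>"
  proof -
    have "2 * y \<in> \<int>" if "y \<in> \<int> \<or> y - 1 / 2 \<in> \<int>" for y :: real
      using that
    proof
      assume "y - 1 / 2 \<in> \<int>"
      then have "2 * (y - 1 / 2) + 1 \<in> \<int>" by (intro Ints_add Ints_mult) auto
      then show ?thesis by simp
    qed auto
    then show "2 * p \<in> \<int>" "2 * q \<in> \<int>" using cases by blast+
  qed
  have sums: "p + q \<in> \<int>" "p - q \<in> \<int>"
  proof -
    have "p + q \<in> \<int> \<and> p - q \<in> \<int>" if half: "p - 1 / 2 \<in> \<int>" "q - 1 / 2 \<in> \<int>"
      using Ints_add[OF Ints_add[OF half] Ints_1] Ints_diff[OF half] by simp
    then show "p + q \<in> \<int>" "p - q \<in> \<int>" using cases by auto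
  qed
  have not_int: "y \<notin> \<int>"
    if "2 * c \<in> \<int>" and ev: "eventually (\<lambda>k. sin (pi * (y + c * k0 + c * real k)) \<noteq> 0) sequentially" for y c :: real
  proof
    assume y: "y \<in> \<int>"
    obtain K where K: "\<And>k. K \<le> k \<Longrightarrow> sin (pi * (y + c * k0 + c * real k)) \<noteq> 0"
      using ev unfolding eventually_sequentially by blast
    \<comment> \<open>The index k0 + 2 K is chosen so that, together with the offset k0, the total
      number of steps is even; as 2 c is an integer, the sine there would vanish.\<close>
    have "y + 2 * c * of_nat (k0 + K) \<in> \<int>"
      by (intro Ints_add[OF y] Ints_mult[OF that(1)] Ints_of_nat)
    moreover have "y + 2 * c * of_nat (k0 + K) = y + c * k0 + c * real (k0 + 2 * K)"
      by (simp add: algebra_simps)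
    ultimately have "y + c * k0 + c * real (k0 + 2 * K) \<in> \<int>" by (simp only:)
    then have "sin ((y + c * k0 + c * real (k0 + 2 * K)) * pi) = 0" by (simp only: sin_times_pi_eq_0)
    then show False using K[of "k0 + 2 * K"] by (simp add: mult.commute)
  qed
  have ints: "\<alpha> \<notin> \<int>" "\<beta> \<notin> \<int>"
  proof -
    show "\<alpha> \<notin> \<int>" by (rule not_int[OF two(1)], rule eventually_mono[OF nz]) simp
    show "\<beta> \<notin> \<int>" by (rule not_int[OF two(2)], rule eventually_mono[OF nz]) simp
  qed
  obtain j where j: "p + q = of_int j" using sums(1) by (auto elim: Ints_cases)
  have floor: "\<lfloor>p + q + r\<rfloor> = j + int \<rho>"
  proof -
    have "p + q + r = of_int (j + int \<rho>)" by (simp add: j r)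
    then show ?thesis by (simp only: floor_of_int)
  qed
  have even_iff: "even \<lfloor>p + q + r\<rfloor> \<longleftrightarrow> cos (pi * (p + q)) = (- 1) ^ \<rho>"
    unfolding floor unfolding j cos_npi_int by (cases "even \<rho>") auto
  have odd_iff: "odd \<lfloor>p + q + r\<rfloor> \<longleftrightarrow> cos (pi * (p + q)) = - ((- 1) ^ \<rho>)"
    unfolding floor unfolding j cos_npi_int by (cases "even \<rho>") auto
  \<comment> \<open>Since p - q and p + q are integers, the offset k0 drops out of the phase
    conditions.\<close>
  have diff: "\<alpha> - \<beta> - 1 / 2 \<in> \<int>" if "\<alpha> + p * k0 - (\<beta> + q * k0) - 1 / 2 \<in> \<int>"
  proof -
    have "\<alpha> + p * k0 - (\<beta> + q * k0) - 1 / 2 - (p - q) * of_nat k0 \<in> \<int>"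
      by (rule Ints_diff[OF that Ints_mult[OF sums(2) Ints_of_nat]])
    then show ?thesis by (simp add: algebra_simps)
  qed
  have sum: "\<alpha> + \<beta> - 1 / 2 \<in> \<int>" if "\<alpha> + p * k0 + (\<beta> + q * k0) - 1 / 2 \<in> \<int>"
  proof -
    have "\<alpha> + p * k0 + (\<beta> + q * k0) - 1 / 2 - (p + q) * of_nat k0 \<in> \<int>"
      by (rule Ints_diff[OF that Ints_mult[OF sums(1) Ints_of_nat]])
    then show ?thesis by (simp add: algebra_simps)
  qed
  show thesis
    by (rule that[OF \<alpha> \<beta> ints]) (use cases diff sum even_iff odd_iff in blast)
qed

lemma arithmetic_conditions:
  assumes "m \<noteq> 0"
    and \<alpha>: "\<And>i. \<alpha> i = of_real p * u i - of_real a" and \<beta>: "\<And>i. \<beta> i = of_real q * u i - of_real b"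
  shows "(r \<in> \<int> \<and> r > 0) \<and>
    ((p \<in> \<int> \<and> q \<in> \<int> \<and> even \<lfloor>p + q + r\<rfloor> \<and>
        (\<forall>i\<in>{1..m}. \<alpha> i \<in> \<real> - \<int> \<and> \<beta> i \<in> \<real> - \<int>))
     \<or>
     (p - 1/2 \<in> \<int> \<and> q - 1/2 \<in> \<int> \<and>
        (\<forall>i\<in>{1..m}. \<alpha> i \<in> \<real> - \<int> \<and> \<beta> i \<in> \<real> - \<int> \<and>
           \<alpha> i - (-1) powi \<lfloor>p + q + r\<rfloor> * \<beta> i - 1/2 \<in> \<int>))) \<and>
    d = complex_of_real (r powr r /
          sqrt (p powr p * q powr q * (r - p) powr (r - p) * (r - q) powr (r - q) *
                x powi \<lfloor>r\<rfloor> * (1 - x) powr (p + q - r)))"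
proof -
  have 1: "1 \<in> {1..m}" using assms(1) by simp
  have r_int: "r \<in> \<int>" by (rule shift_parameter_ints(1)[OF 1])
  then obtain \<rho> where r: "r = real \<rho>"
    using r_pos by (metis Ints_cases of_int_0_less_iff of_int_of_nat_eq zero_less_imp_eq_int)
  have reals: "\<alpha> i \<in> \<real> - \<int> \<and> \<beta> i \<in> \<real> - \<int>" if i: "i \<in> {1..m}" for i
  proof -
    obtain A B :: real where "\<alpha> i = of_real A" "\<beta> i = of_real B" "A \<notin> \<int>" "B \<notin> \<int>"
      by (rule exponent_dichotomy[OF i r, folded \<alpha> \<beta>]) (rule that)
    then show ?thesis by simp
  qed
  \<comment> \<open>Integers and half-integers exclude each other, so the alternative, decided by p
    alone, is the same for every index i.\<close>
  have not_both: "\<not> (p \<in> \<int> \<and> p - 1 / 2 \<in> \<int>)"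
  proof
    assume "p \<in> \<int> \<and> p - 1 / 2 \<in> \<int>"
    then have "p - (p - 1 / 2) \<in> \<int>" by (intro Ints_diff) auto
    then show False using fraction_not_in_Ints[where 'a = real, of 2 1] by simp
  qed
  have "(p \<in> \<int> \<and> q \<in> \<int> \<and> even \<lfloor>p + q + r\<rfloor>) \<or>
     (p - 1/2 \<in> \<int> \<and> q - 1/2 \<in> \<int> \<and>
        (\<forall>i\<in>{1..m}. \<alpha> i - (-1) powi \<lfloor>p + q + r\<rfloor> * \<beta> i - 1/2 \<in> \<int>))"
  proof (cases "p \<in> \<int>")
    case True
    show ?thesis
      by (rule exponent_dichotomy[OF 1 r]) (use True not_both in blast)
  next
    case False
    have "\<alpha> i - (-1) powi \<lfloor>p + q + r\<rfloor> * \<beta> i - 1/2 \<in> \<int>" if i: "i \<in> {1..m}" for i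
    proof -
      obtain A B :: real where AB: "\<alpha> i = of_real A" "\<beta> i = of_real B"
        "even \<lfloor>p + q + r\<rfloor> \<and> A - B - 1 / 2 \<in> \<int> \<or> odd \<lfloor>p + q + r\<rfloor> \<and> A + B - 1 / 2 \<in> \<int>"
      proof (rule exponent_dichotomy[OF i r, folded \<alpha> \<beta>])
        fix A B :: real
        assume "\<alpha> i = of_real A" "\<beta> i = of_real B"
          and "(p \<in> \<int> \<and> q \<in> \<int> \<and> even \<lfloor>p + q + r\<rfloor>) \<or>
            (p - 1 / 2 \<in> \<int> \<and> q - 1 / 2 \<in> \<int> \<and>
              (even \<lfloor>p + q + r\<rfloor> \<and> A - B - 1 / 2 \<in> \<int> \<or> odd \<lfloor>p + q + r\<rfloor> \<and> A + B - 1 / 2 \<in> \<int>))"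
        then show thesis using False by (intro that[of A B]) blast+
      qed
      have eq: "\<alpha> i - (-1) powi \<lfloor>p + q + r\<rfloor> * \<beta> i - 1/2 =
          of_real (if even \<lfloor>p + q + r\<rfloor> then A - B - 1 / 2 else A + B - 1 / 2)"
        by (simp add: AB(1,2) power_int_minus_left)
      show ?thesis unfolding eq of_real_in_Ints_iff using AB(3) by auto
    qed
    moreover have "p - 1/2 \<in> \<int> \<and> q - 1/2 \<in> \<int>"
      by (rule exponent_dichotomy[OF 1 r]) (use False in blast)
    ultimately show ?thesis by blast
  qed
  then show ?thesis
    using r_int r_pos reals dilation_constant_closed_form[OF 1 r] by blast
qed

end

theorem theorem2p4:
  fixes p q r a b x :: real
    and S :: "complex \<Rightarrow> complex" and d :: complex
    and m :: nat and u v :: "nat \<Rightarrow> complex"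
    and \<alpha> \<beta> :: "nat \<Rightarrow> complex"
  assumes "0 < p" "p < r" "0 < q" "q < r" "-1 < x" "x < 1" "x \<noteq> 0"
    and "closed_form_solution p q r a b x"
    and "\<not> elementary p q r a b x"
    and "canonical_form (shift_ratio (hyp_f p q r a b x)) S d m u m v"
    and "\<And>i. \<alpha> i = p * u i - a"
    and "\<And>i. \<beta> i = q * u i - b"
  shows "(r \<in> \<int> \<and> r > 0) \<and>
    ((p \<in> \<int> \<and> q \<in> \<int> \<and> even \<lfloor>p + q + r\<rfloor> \<and>
        (\<forall>i\<in>{1..m}. \<alpha> i \<in> \<real> - \<int> \<and> \<beta> i \<in> \<real> - \<int>))
     \<or>
     (p - 1/2 \<in> \<int> \<and> q - 1/2 \<in> \<int> \<and>
        (\<forall>i\<in>{1..m}. \<alpha> i \<in> \<real> - \<int> \<and> \<beta> i \<in> \<real> - \<int> \<and>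
           \<alpha> i - (-1) powi \<lfloor>p + q + r\<rfloor> * \<beta> i - 1/2 \<in> \<int>))) \<and>
    d = complex_of_real (r powr r /
          sqrt (p powr p * q powr q * (r - p) powr (r - p) * (r - q) powr (r - q) *
                x powi \<lfloor>r\<rfloor> * (1 - x) powr (p + q - r)))"
proof -
  interpret gauss_parameters p q r a b x
    using assms(1-7) by unfold_locales
  obtain P Q where PQ: "P \<noteq> 0" "Q \<noteq> 0"
    "\<And>w. denom w * numer (w + 1) * poly P w * poly Q (w + 1) * (\<Prod>j=1..m. w + v j) =
         denom (w + 1) * numer w * poly P (w + 1) * poly Q w * (d * (\<Prod>i=1..m. w + u i))"
    using canonical_form_identity[OF assms(10)] by blast
  interpret gauss_gamma_product p q r a b x P Q d m u v
    using assms(10) PQ by unfold_locales (auto simp: canonical_form_def)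
  have "m \<noteq> 0" using finite_poles assms(9) unfolding elementary_def by blast
  then show ?thesis using assms(11,12) by (rule arithmetic_conditions)
qed

end
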